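(* Let $\mathcal{C}\subset[0,1]$ be the middle-thirds Cantor set, let $\alpha\in\mathbb{R}$ be irrational, let $\beta\in\mathbb{R}$, and let $K=\alpha\cdot\mathcal{C}+\beta=\{\alpha c+\beta:c\in\mathcal{C}\}$, which is the attractor of the IFS $$\Phi=\left\{x\mapsto\tfrac13x+\tfrac{2\beta}{3},\ \ x\mapsto\tfrac13x+\tfrac{2\alpha}{3}+\tfrac{2\beta}{3}\right\}.$$ Then with respect to any $\Phi$-Bernoulli measure on $K$, almost every point is normal to every integer base $D\ge2$.
   Context: For an IFS $\Phi=\{\varphi_i\}_{i\in\Lambda}$ (a finite collection of contractions of $\mathbb{R}$), the attractor is the unique non-empty compact set $K$ with $K=\bigcup_{i\in\Lambda}\varphi_i(K)$, and the coding map $\pi_\Phi:\Lambda^{\mathbb{N}}\to K$ is $\pi_\Phi(i_1,i_2,\dots)=\lim_{n\to\infty}\varphi_{i_1}\circ\cdots\circ\varphi_{i_n}(0)$. A $\Phi$-Bernoulli measure is a measure of the form $(\pi_\Phi)_*P^{\otimes\mathbb{N}}$, where $P$ is a probability measure on $\Lambda$ with $P(\{i\})>0$ for all $i\in\Lambda$. For an integer $D\ge2$, a real number $x$ is normal to base $D$ if for every $n\in\mathbb{N}$ every word in $\{0,\dots,D-1\}^n$ occurs in the base $D$ expansion of $x$ with asymptotic frequency $D^{-n}$; equivalently, $(D^mx \bmod 1)_{m}$ is equidistributed in $[0,1]$ with respect to Lebesgue measure. *)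

theory Defs
  imports "HOL-Probability.Probability"
begin

fun cantor_step :: "nat \<Rightarrow> real set" where
  "cantor_step 0 = {0..1}"
| "cantor_step (Suc n) = (\<lambda>x. x / 3) ` cantor_step n \<union> (\<lambda>x. x / 3 + 2 / 3) ` cantor_step n"

definition cantor_set :: "real set" where
  "cantor_set = (\<Inter>n. cantor_step n)"

(* A finite collection of maps is a family indexed by a finite type. *)
definition is_ifs :: "('i::finite \<Rightarrow> real \<Rightarrow> real) \<Rightarrow> bool" where
  "is_ifs \<Phi> \<longleftrightarrow> (\<forall>i. \<exists>L<1. L-lipschitz_on UNIV (\<Phi> i))"

definition invariant_compact :: "('i::finite \<Rightarrow> real \<Rightarrow> real) \<Rightarrow> real set \<Rightarrow> bool" where
  "invariant_compact \<Phi> K \<longleftrightarrow> K \<noteq> {} \<and> compact K \<and> K = (\<Union>i. \<Phi> i ` K)"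

definition is_attractor :: "('i::finite \<Rightarrow> real \<Rightarrow> real) \<Rightarrow> real set \<Rightarrow> bool" where
  "is_attractor \<Phi> K \<longleftrightarrow> invariant_compact \<Phi> K \<and> (\<forall>K'. invariant_compact \<Phi> K' \<longrightarrow> K' = K)"

(* The foldr is the composition \<Phi> (\<omega> 0) \<circ> \<dots> \<circ> \<Phi> (\<omega> (n - 1)) applied to 0. *)
definition coding_map :: "('i::finite \<Rightarrow> real \<Rightarrow> real) \<Rightarrow> (nat \<Rightarrow> 'i) \<Rightarrow> real" where
  "coding_map \<Phi> \<omega> = lim (\<lambda>n. foldr \<Phi> (map \<omega> [0..<n]) 0)"

(* The measure is carried by the real line; it gives full mass to the attractor. *)
definition bernoulli_measure :: "('i::finite \<Rightarrow> real \<Rightarrow> real) \<Rightarrow> real measure \<Rightarrow> bool" where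
  "bernoulli_measure \<Phi> \<mu> \<longleftrightarrow>
     (\<exists>P :: 'i pmf. (\<forall>i. pmf P i > 0) \<and>
        \<mu> = distr (\<Pi>\<^sub>M n\<in>(UNIV :: nat set). measure_pmf P) borel (coding_map \<Phi>))"

(* The n-th fractional digit (from n = 0) of x - \<lfloor>x\<rfloor> in base D. Reducing mod D discards the
   integer part, so this also makes sense for negative x. *)
definition base_digit :: "nat \<Rightarrow> real \<Rightarrow> nat \<Rightarrow> nat" where
  "base_digit D x n = nat (\<lfloor>real D ^ Suc n * x\<rfloor> mod int D)"

definition normal_to_base :: "nat \<Rightarrow> real \<Rightarrow> bool" where
  "normal_to_base D x \<longleftrightarrow>
     (\<forall>w. set w \<subseteq> {..<D} \<longrightarrow>
        (\<lambda>N. real (card {m. m < N \<and> (\<forall>j<length w. base_digit D x (m + j) = w ! j)}) / real N)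
          \<longlonglongrightarrow> 1 / real D ^ length w)"

end

theory Submission
  imports Defs "HOL-Library.Discrete_Functions"
begin

text \<open>
  A point that is distributed according to a Bernoulli measure of the system is \<open>X = \<alpha> Y + \<beta>\<close>, where
  \<open>Y\<close> is the sum of \<open>2 i\<^sub>k / 3\<^sup>k\<^sup>+\<^sup>1\<close> and the \<open>i\<^sub>k\<close> are independent tosses of a biased coin. By Weyl's
  criterion (\<open>normal_to_base_if_weyl\<close>) it suffices that for every base \<open>D\<close> and every integer \<open>h \<noteq> 0\<close> the
  averages of \<open>e (h D\<^sup>n X)\<close> over \<open>n < N\<close> tend to 0 almost surely, where \<open>e t = exp (2 \<pi> \<i> t)\<close>.

  Let \<open>3\<^sup>s\<close> be the largest power of 3 that is at most \<open>D\<^sup>n\<close>. The ternary digits of \<open>Y\<close> with index at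
  least \<open>s + l\<close> hardly influence \<open>e (h D\<^sup>n X)\<close>, so they may be cut off. From the truncated exponential
  subtract its conditional expectation given the digits with index less than \<open>s - l\<close>. The differences
  are bounded, and those that belong to sufficiently distant \<open>n\<close> are orthogonal; hence their averages
  tend to 0 almost surely (\<open>AE_average_orthogonal\<close>, \<open>AE_average_fluctuation\<close>).

  What remains is the conditional expectation, whose modulus does not depend on the point. It is at
  most a product of \<open>l\<close> factors, the moduli of the characteristic function of one coin at the angles
  \<open>2 \<pi> 3\<^sup>j t\<close> for \<open>j < l\<close>, where \<open>t = 2 h \<alpha> y\<close> and \<open>y = D\<^sup>n / 3\<^sup>s\<close> is the ternary mantissa of
  \<open>D\<^sup>n\<close>, a number between 1 and 3. For growing \<open>l\<close> this product decreases to 0 unless some \<open>3\<^sup>j t\<close> is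
  an integer (\<open>damping_tendsto_0\<close>). The exceptional \<open>y\<close> form a countable set, and since \<open>\<alpha>\<close> is
  irrational and \<open>y\<close> is rational, no mantissa is exceptional.

  The averages over \<open>n\<close> are small too, because the mantissas cannot accumulate at an exceptional point
  with positive frequency: if no positive power of \<open>D\<close> is a power of 3, then returns to a short interval take a
  long time, and otherwise there are only finitely many mantissas (\<open>mantissa3_no_atom\<close>). A compactness
  argument turns this into the required bound (\<open>average_small_off_countable\<close>). In this way powers of 3
  and all other bases are treated together.
\<close>

section \<open>The scaled Cantor set as an attractor\<close>

text \<open>
  At a point of \<^term>\<open>K'\<close> that is farthest from \<^term>\<open>K\<close>, invariance of both sets and contraction
  bound the maximal distance by a fraction of itself, so it vanishes.
\<close>
lemma invariant_compact_unique_subset: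
  assumes ifs: "is_ifs \<Phi>" and K: "invariant_compact \<Phi> K" and K': "invariant_compact \<Phi> K'"
  shows "K' \<subseteq> K"
proof -
  have Kne: "K \<noteq> {}" and Kcl: "closed K" and Kinv: "K = (\<Union>i. \<Phi> i ` K)"
    using K by (auto simp: invariant_compact_def compact_imp_closed)
  have "compact K'" "K' \<noteq> {}" and Kinv': "K' = (\<Union>i. \<Phi> i ` K')"
    using K' by (auto simp: invariant_compact_def)
  moreover have "continuous_on K' (\<lambda>y. infdist y K)"
    by (intro continuous_intros)
  ultimately obtain x where x: "x \<in> K'" and xmax: "\<And>y. y \<in> K' \<Longrightarrow> infdist y K \<le> infdist x K"
    using continuous_attains_sup[of K' "\<lambda>y. infdist y K"] by blast
  obtain i x' where x': "x' \<in> K'" "x = \<Phi> i x'" using Kinv' x by blast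
  obtain L where L: "L < 1" "L-lipschitz_on UNIV (\<Phi> i)"
    using ifs by (auto simp: is_ifs_def)
  have L0: "L \<ge> 0" using L(2) by (rule lipschitz_on_nonneg)
  obtain z where z: "z \<in> K" "infdist x' K = dist x' z"
    using infdist_attains_inf[OF Kcl Kne] by metis
  have "\<Phi> i z \<in> K" using Kinv z(1) by blast
  then have "infdist x K \<le> dist x (\<Phi> i z)" by (rule infdist_le)
  also have "\<dots> \<le> L * dist x' z"
    using lipschitz_onD[OF L(2)] x'(2) by simp
  also have "\<dots> \<le> L * infdist x K"
    using z(2) xmax[OF x'(1)] L0 by (simp add: mult_left_mono)
  finally have "(1 - L) * infdist x K \<le> 0" by (simp add: algebra_simps)
  then have "infdist x K \<le> 0" using L(1) by (simp add: mult_le_0_iff)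
  then have "infdist y K = 0" if "y \<in> K'" for y
    using xmax[OF that] infdist_nonneg[of y K] by linarith
  then show ?thesis
    using in_closed_iff_infdist_zero[OF Kcl Kne] by blast
qed

lemma is_attractorI:
  assumes "is_ifs \<Phi>" "invariant_compact \<Phi> K"
  shows "is_attractor \<Phi> K"
  unfolding is_attractor_def
  using assms invariant_compact_unique_subset by (metis subset_antisym)

lemma cantor_step_compact: "compact (cantor_step n)"
proof (induction n)
  case (Suc n)
  then show ?case
    by (auto intro!: compact_Un compact_continuous_image continuous_intros)
qed simp

lemma cantor_step_subset_unit: "cantor_step n \<subseteq> {0..1}"
proof (induction n)
  case (Suc n)
  then show ?case by (force simp: subset_iff)
qed simp

lemma zero_in_cantor_step: "0 \<in> cantor_step n"
  by (induction n) (auto intro!: image_eqI[of _ _ 0])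

lemma cantor_step_decreasing: "cantor_step (Suc n) \<subseteq> cantor_step n"
proof (induction n)
  case 0
  show ?case using cantor_step_subset_unit[of "Suc 0"] by simp
next
  case (Suc n)
  have "cantor_step (Suc (Suc n)) =
      (\<lambda>x. x / 3) ` cantor_step (Suc n) \<union> (\<lambda>x. x / 3 + 2 / 3) ` cantor_step (Suc n)" by simp
  also have "\<dots> \<subseteq> (\<lambda>x. x / 3) ` cantor_step n \<union> (\<lambda>x. x / 3 + 2 / 3) ` cantor_step n"
    by (intro Un_mono image_mono Suc)
  finally show ?case by simp
qed

text \<open>
  The two images at each level lie on different sides of \<open>1/2\<close>, so a point of all levels is on the
  same branch at every level; this is what lets the intersection pass through the union.
\<close>
lemma cantor_set_self_similar:
  "cantor_set = (\<lambda>x. x / 3) ` cantor_set \<union> (\<lambda>x. x / 3 + 2 / 3) ` cantor_set"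
proof (intro equalityI subsetI)
  fix x assume x: "x \<in> cantor_set"
  then have step: "x \<in> (\<lambda>x. x / 3) ` cantor_step n \<union> (\<lambda>x. x / 3 + 2 / 3) ` cantor_step n" for n
    unfolding cantor_set_def using cantor_step.simps(2) by blast
  show "x \<in> (\<lambda>x. x / 3) ` cantor_set \<union> (\<lambda>x. x / 3 + 2 / 3) ` cantor_set"
  proof (cases "x \<le> 1 / 2")
    case True
    have "3 * x \<in> cantor_step n" for n
      using step[of n] cantor_step_subset_unit[of n] True by (force dest: subsetD)
    then have "3 * x \<in> cantor_set" by (simp add: cantor_set_def)
    then show ?thesis by (intro UnI1 image_eqI[of _ _ "3 * x"]) auto
  next
    case False
    have "3 * x - 2 \<in> cantor_step n" for n
      using step[of n] cantor_step_subset_unit[of n] False by (force dest: subsetD)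
    then have "3 * x - 2 \<in> cantor_set" by (simp add: cantor_set_def)
    then show ?thesis by (intro UnI2 image_eqI[of _ _ "3 * x - 2"]) (auto simp: field_simps)
  qed
next
  fix x assume "x \<in> (\<lambda>x. x / 3) ` cantor_set \<union> (\<lambda>x. x / 3 + 2 / 3) ` cantor_set"
  then have "x \<in> cantor_step (Suc n)" for n
    by (auto simp: cantor_set_def)
  then show "x \<in> cantor_set"
    unfolding cantor_set_def using cantor_step_decreasing by blast
qed

lemma compact_cantor_set: "compact cantor_set"
  unfolding cantor_set_def by (rule compact_Inter) (auto simp: cantor_step_compact)

lemma zero_in_cantor_set: "0 \<in> cantor_set"
  by (simp add: cantor_set_def zero_in_cantor_step)

definition scaled_cantor_ifs :: "real \<Rightarrow> real \<Rightarrow> bool \<Rightarrow> real \<Rightarrow> real" where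
  "scaled_cantor_ifs \<alpha> \<beta> = (\<lambda>i. if i then (\<lambda>x. 1 / 3 * x + 2 * \<alpha> / 3 + 2 * \<beta> / 3)
                                 else (\<lambda>x. 1 / 3 * x + 2 * \<beta> / 3))"

lemma scaled_cantor_ifs_is_ifs: "is_ifs (scaled_cantor_ifs \<alpha> \<beta>)"
proof -
  have "(1/3)-lipschitz_on UNIV (scaled_cantor_ifs \<alpha> \<beta> i)" for i
    by (rule lipschitz_onI)
      (auto simp: scaled_cantor_ifs_def dist_real_def abs_mult simp flip: diff_divide_distrib)
  then show ?thesis
    unfolding is_ifs_def by (intro allI exI[of _ "1/3"]) auto
qed

lemma scaled_cantor_ifs_attractor:
  "is_attractor (scaled_cantor_ifs \<alpha> \<beta>) ((\<lambda>c. \<alpha> * c + \<beta>) ` cantor_set)"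
    (is "is_attractor ?\<Phi> ?K")
proof (rule is_attractorI[OF scaled_cantor_ifs_is_ifs])
  have "(\<lambda>c. \<alpha> * c + \<beta>) ` cantor_set = (\<lambda>c. \<alpha> * c + \<beta>) ` ((\<lambda>x. x / 3) ` cantor_set \<union> (\<lambda>x. x / 3 + 2 / 3) ` cantor_set)"
    using cantor_set_self_similar by simp
  also have "\<dots> = ?\<Phi> False ` ?K \<union> ?\<Phi> True ` ?K"
    unfolding image_Un image_image scaled_cantor_ifs_def
    by (intro arg_cong2[where f = "(\<union>)"] image_cong) (auto simp: field_simps)
  also have "\<dots> = (\<Union>i. ?\<Phi> i ` ?K)"
    by (simp add: UNIV_bool Un_commute)
  finally have "?K = (\<Union>i. ?\<Phi> i ` ?K)" .
  moreover have "compact ?K"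
    by (intro compact_continuous_image compact_cantor_set continuous_intros)
  moreover have "?K \<noteq> {}" using zero_in_cantor_set by blast
  ultimately show "invariant_compact ?\<Phi> ?K"
    unfolding invariant_compact_def by blast
qed

section \<open>From Weyl sums to normality\<close>

lemma cos_two_pi_has_integral:
  fixes m :: int
  shows "((\<lambda>x. cos (2 * pi * m * x)) has_integral (if m = (0::int) then 1 else 0)) {-1/2..1/2::real}"
proof (cases "m = 0")
  case True
  then show ?thesis using has_integral_const_real[of "1::real" "-1/2" "1/2"] by simp
next
  case False
  let ?F = "\<lambda>x::real. sin (2 * pi * m * x) / (2 * pi * m)"
  have "((\<lambda>x. cos (2 * pi * m * x)) has_integral (?F (1/2) - ?F (-1/2))) {-1/2..1/2}"
    using False by (intro fundamental_theorem_of_calculus)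
      (auto intro!: derivative_eq_intros simp flip: has_real_derivative_iff_has_vector_derivative)
  moreover have "?F (1/2) - ?F (-1/2) = 0"
    using sin_int_times_real[of m pi] by (simp add: mult.commute)
  ultimately show ?thesis using False by simp
qed

text \<open>
  Equidistribution is extracted from Weyl sums through polynomials in the single function
  \<open>cos (2 \<pi> (x - c))\<close>: an arc with centre \<open>c\<close> is a superlevel set of this function, so approximating
  its indicator is a one-variable Weierstrass problem on \<open>[-1, 1]\<close>.
\<close>
locale weyl_sequence =
  fixes z :: "nat \<Rightarrow> real"
  assumes weyl: "\<And>h::int. h \<noteq> (0::int) \<Longrightarrow>
    (\<lambda>N. (\<Sum>n<N. cis (2 * pi * h * z n)) / of_nat N) \<longlonglongrightarrow> 0"
begin

definition average :: "(real \<Rightarrow> real) \<Rightarrow> nat \<Rightarrow> real" where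
  "average f N = (\<Sum>n<N. f (z n)) / real N"

lemma average_cos:
  fixes m :: int
  shows "average (\<lambda>x. cos (2 * pi * m * (x - c))) \<longlonglongrightarrow> (if m = (0::int) then 1 else 0)"
proof (cases "m = 0")
  case True
  have "\<forall>\<^sub>F N in sequentially. average (\<lambda>x. cos (2 * pi * m * (x - c))) N = 1"
    using eventually_gt_at_top[of "0::nat"]
    by eventually_elim (simp add: True average_def)
  then show ?thesis using True by (simp add: tendsto_eventually)
next
  case False
  have "(\<lambda>N. Re (cis (- 2 * pi * m * c) * ((\<Sum>n<N. cis (2 * pi * m * z n)) / of_nat N)))
      \<longlonglongrightarrow> Re (cis (- 2 * pi * m * c) * 0)"
    by (intro tendsto_Re tendsto_mult_left weyl[OF False])
  also have "(\<lambda>N. Re (cis (- 2 * pi * m * c) * ((\<Sum>n<N. cis (2 * pi * m * z n)) / of_nat N)))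
      = average (\<lambda>x. cos (2 * pi * m * (x - c)))"
  proof
    fix N
    have "cis (- 2 * pi * m * c) * ((\<Sum>n<N. cis (2 * pi * m * z n)) / of_nat N)
        = (\<Sum>n<N. cis (2 * pi * m * (z n - c))) / of_nat N"
      by (simp add: sum_distrib_left cis_mult algebra_simps)
    also have "Re \<dots> = (\<Sum>n<N. cos (2 * pi * m * (z n - c))) / real N"
      by (simp only: Re_divide_of_nat Re_sum cis.sel)
    finally show "Re (cis (- 2 * pi * m * c) * ((\<Sum>n<N. cis (2 * pi * m * z n)) / of_nat N))
      = average (\<lambda>x. cos (2 * pi * m * (x - c))) N"
      by (simp only: average_def)
  qed
  finally show ?thesis using False by simp
qed

lemma average_add: "average (\<lambda>x. f x + g x) N = average f N + average g N"
  by (simp add: average_def sum.distrib add_divide_distrib)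

lemma average_cmult: "average (\<lambda>x. a * f x) N = a * average f N"
  by (simp add: average_def sum_distrib_left)

lemma average_sum: "average (\<lambda>x. \<Sum>i\<in>I. f i x) N = (\<Sum>i\<in>I. average (f i) N)"
  unfolding average_def by (subst sum.swap) (simp add: sum_divide_distrib)

lemma average_mono: "(\<And>x. f x \<le> g x) \<Longrightarrow> average f N \<le> average g N"
  unfolding average_def by (intro divide_right_mono sum_mono) auto

text \<open>
  The extra factor \<open>cos (2 \<pi> m x)\<close> makes the induction work: multiplying by one more cosine shifts
  the frequency \<open>m\<close> up and down by one. Integral and limit of averages obey the same recursion, so
  they agree, whatever the centre \<open>c\<close> is.
\<close>
lemma average_cos_power_cos:
  fixes m :: int
  shows "\<exists>I. ((\<lambda>x. cos (2 * pi * x) ^ k * cos (2 * pi * m * x)) has_integral I) {-1/2..1/2} \<and>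
    average (\<lambda>x. cos (2 * pi * (x - c)) ^ k * cos (2 * pi * m * (x - c))) \<longlonglongrightarrow> I"
proof (induction k arbitrary: m)
  case 0
  show ?case using cos_two_pi_has_integral average_cos by fastforce
next
  case (Suc k)
  let ?f = "\<lambda>k m x. cos (2 * pi * x) ^ k * cos (2 * pi * of_int m * x)"
  have prod: "?f (Suc k) m = (\<lambda>x. 1/2 * ?f k (m + 1) x + 1/2 * ?f k (m - 1) x)"
  proof
    fix x
    have "cos (2 * pi * x) * cos (2 * pi * m * x)
        = (cos (2 * pi * of_int (m + 1) * x) + cos (2 * pi * of_int (m - 1) * x)) / 2"
      by (simp add: algebra_simps cos_add cos_diff)
    moreover have "?f (Suc k) m x = cos (2 * pi * x) ^ k * (cos (2 * pi * x) * cos (2 * pi * m * x))"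
      by simp
    ultimately show "?f (Suc k) m x = 1/2 * ?f k (m + 1) x + 1/2 * ?f k (m - 1) x"
      by (simp only: distrib_left add_divide_distrib)
  qed
  obtain I where I: "(?f k (m + 1) has_integral I) {-1/2..1/2}"
    "average (\<lambda>x. ?f k (m + 1) (x - c)) \<longlonglongrightarrow> I" using Suc[of "m + 1"] by auto
  obtain J where J: "(?f k (m - 1) has_integral J) {-1/2..1/2}"
    "average (\<lambda>x. ?f k (m - 1) (x - c)) \<longlonglongrightarrow> J" using Suc[of "m - 1"] by auto
  have "(?f (Suc k) m has_integral (1/2 * I + 1/2 * J)) {-1/2..1/2}"
    unfolding prod by (intro has_integral_add has_integral_mult_right I J)
  moreover have "average (\<lambda>x. ?f (Suc k) m (x - c)) = (\<lambda>N. 1/2 * average (\<lambda>x. ?f k (m + 1) (x - c)) N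
      + 1/2 * average (\<lambda>x. ?f k (m - 1) (x - c)) N)"
    unfolding fun_cong[OF prod] by (rule ext) (simp only: average_add average_cmult)
  then have "average (\<lambda>x. ?f (Suc k) m (x - c)) \<longlonglongrightarrow> 1/2 * I + 1/2 * J"
    using I J by (auto intro!: tendsto_intros)
  ultimately show ?case by blast
qed

lemma average_polynomial_cos:
  assumes "real_polynomial_function p"
  shows "\<exists>I. ((\<lambda>x. p (cos (2 * pi * x))) has_integral I) {-1/2..1/2} \<and>
    average (\<lambda>x. p (cos (2 * pi * (x - c)))) \<longlonglongrightarrow> I"
proof -
  obtain a d where p: "p = (\<lambda>x. \<Sum>i\<le>d. a i * x ^ i)"
    using assms real_polynomial_function_iff_sum by blast
  have "\<forall>k. \<exists>I. ((\<lambda>x. cos (2 * pi * x) ^ k) has_integral I) {-1/2..1/2} \<and>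
    average (\<lambda>x. cos (2 * pi * (x - c)) ^ k) \<longlonglongrightarrow> I"
    using average_cos_power_cos[of _ 0 c] by simp
  then obtain I where I: "\<And>k. ((\<lambda>x. cos (2 * pi * x) ^ k) has_integral I k) {-1/2..1/2}"
    "\<And>k. average (\<lambda>x. cos (2 * pi * (x - c)) ^ k) \<longlonglongrightarrow> I k" by metis
  have "((\<lambda>x. p (cos (2 * pi * x))) has_integral (\<Sum>i\<le>d. a i * I i)) {-1/2..1/2}"
    unfolding p by (intro has_integral_sum has_integral_mult_right I finite_atMost)
  moreover have "average (\<lambda>x. p (cos (2 * pi * (x - c)))) \<longlonglongrightarrow> (\<Sum>i\<le>d. a i * I i)"
    unfolding p average_sum average_cmult by (intro tendsto_intros I)
  ultimately show ?thesis by blast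
qed

text \<open>
  The indicator of the arc lies below a continuous function of the cosine that vanishes outside a
  slightly longer arc; a uniformly close polynomial has convergent averages, and the limit is at most
  the length of the longer arc plus the approximation error.
\<close>
lemma arc_frequency_upper:
  assumes s: "0 < s" "s < 1/2" and \<epsilon>: "\<epsilon> > 0"
  shows "\<forall>\<^sub>F N in sequentially.
    average (\<lambda>x. of_bool (cos (2 * pi * (x - c)) \<ge> cos (2 * pi * s))) N \<le> 2 * s + \<epsilon>"
proof -
  \<comment> \<open>A half-width slightly larger than \<open>s\<close> that still leaves an arc shorter than the circle.\<close>
  define s' where "s' = min (s + \<epsilon> / 8) ((s + 1/2) / 2)"
  have s': "s < s'" "s' < 1/2" "s' \<le> s + \<epsilon> / 8" using s \<epsilon> by (auto simp: s'_def min_def)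
  define u v where "u = cos (2 * pi * s)" and "v = cos (2 * pi * s')"
  have vu: "v < u" unfolding u_def v_def using s s' by (intro cos_monotone_0_pi) auto
  define F where "F t = max 0 (min 1 ((t - v) / (u - v)))" for t
  have F: "F t \<ge> 0" "F t \<le> 1" "t \<ge> u \<Longrightarrow> F t = 1" "t \<le> v \<Longrightarrow> F t = 0" for t
    using vu by (auto simp: F_def min_def max_def field_simps)
  have "continuous_on {-1..1} F" unfolding F_def using vu by (intro continuous_intros) auto
  then obtain p where p: "real_polynomial_function p" "\<And>t. t \<in> {-1..1} \<Longrightarrow> \<bar>F t - p t\<bar> < \<epsilon> / 8"
    using Stone_Weierstrass_real_polynomial_function[of "{-1..1}" F "\<epsilon> / 8"] \<epsilon> by auto
  have p': "F (cos x) \<le> p (cos x) + \<epsilon> / 8" "p (cos x) \<le> F (cos x) + \<epsilon> / 8" for x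
  proof -
    have "\<bar>F (cos x) - p (cos x)\<bar> < \<epsilon> / 8" using p(2)[of "cos x"] by simp
    then show "F (cos x) \<le> p (cos x) + \<epsilon> / 8" "p (cos x) \<le> F (cos x) + \<epsilon> / 8" by linarith+
  qed
  obtain I where I: "((\<lambda>x. p (cos (2 * pi * x))) has_integral I) {-1/2..1/2}"
    "average (\<lambda>x. p (cos (2 * pi * (x - c)))) \<longlonglongrightarrow> I"
    using average_polynomial_cos[OF p(1)] by blast
  \<comment> \<open>The polynomial is dominated by this function over one period centred at 0.\<close>
  let ?g = "\<lambda>x. (if x \<in> {-s'..s'} then 1 else 0) + \<epsilon> / 8"
  have "((\<lambda>x. if x \<in> {-s'..s'} then 1 else 0::real) has_integral 2 * s') {-1/2..1/2}"
    using has_integral_restrict_closed_subintervals_eq[of "-s'" s' "-1/2" "1/2" "\<lambda>_. 1::real" "2 * s'"]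
      has_integral_const_real[of "1::real" "-s'" s'] s s' by simp
  moreover have "((\<lambda>_. \<epsilon> / 8) has_integral \<epsilon> / 8) {-1/2..1/2::real}"
    using has_integral_const_real[of "\<epsilon> / 8" "-1/2" "1/2"] by simp
  ultimately have g: "(?g has_integral (2 * s' + \<epsilon> / 8)) {-1/2..1/2}"
    by (rule has_integral_add)
  have "I \<le> 2 * s' + \<epsilon> / 8"
  proof (rule has_integral_le[OF I(1) g])
    fix x :: real assume x: "x \<in> {-1/2..1/2}"
    have "F (cos (2 * pi * x)) \<le> (if x \<in> {-s'..s'} then 1 else 0)"
    proof (cases "\<bar>x\<bar> \<le> s'")
      case True
      then show ?thesis using F(2) by auto
    next
      case False
      have "cos (2 * pi * \<bar>x\<bar>) \<le> cos (2 * pi * s')"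
        using False x s s' by (intro cos_monotone_0_pi_le) auto
      then have "cos (2 * pi * x) \<le> v" by (cases "x \<ge> 0") (auto simp: v_def)
      then show ?thesis using F(4) False by auto
    qed
    then show "p (cos (2 * pi * x)) \<le> ?g x" using p'(2)[of "2 * pi * x"] by linarith
  qed
  then have "I < 2 * s + \<epsilon> / 2" using s' \<epsilon> by linarith
  then have "\<forall>\<^sub>F N in sequentially. average (\<lambda>x. p (cos (2 * pi * (x - c)))) N < 2 * s + \<epsilon> / 2"
    using I(2) by (rule order_tendstoD(2)[rotated])
  then show ?thesis using eventually_gt_at_top[of "0::nat"]
  proof eventually_elim
    fix N assume N: "average (\<lambda>x. p (cos (2 * pi * (x - c)))) N < 2 * s + \<epsilon> / 2" "0 < N"
    have "average (\<lambda>x. of_bool (cos (2 * pi * (x - c)) \<ge> cos (2 * pi * s))) N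
      \<le> average (\<lambda>x. p (cos (2 * pi * (x - c))) + \<epsilon> / 8) N"
    proof (rule average_mono)
      fix x
      have "of_bool (cos (2 * pi * (x - c)) \<ge> cos (2 * pi * s)) \<le> F (cos (2 * pi * (x - c)))"
        using F(1,3) by (auto simp: u_def)
      then show "of_bool (cos (2 * pi * (x - c)) \<ge> cos (2 * pi * s)) \<le> p (cos (2 * pi * (x - c))) + \<epsilon> / 8"
        using p'(1)[of "2 * pi * (x - c)"] by linarith
    qed
    also have "\<dots> = average (\<lambda>x. p (cos (2 * pi * (x - c)))) N + \<epsilon> / 8"
      using N(2) unfolding average_add by (simp add: average_def)
    finally show "average (\<lambda>x. of_bool (cos (2 * pi * (x - c)) \<ge> cos (2 * pi * s))) N \<le> 2 * s + \<epsilon>"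
      using N(1) \<epsilon> by linarith
  qed
qed

lemma cos_two_pi_frac: "cos (2 * pi * (x - c)) = cos (2 * pi * \<bar>frac x - c\<bar>)"
proof -
  have "2 * pi * (x - c) = 2 * pi * (frac x - c) + of_int \<lfloor>x\<rfloor> * (2 * pi)"
    by (simp add: frac_def algebra_simps)
  then have "cos (2 * pi * (x - c)) = cos (2 * pi * (frac x - c))"
    using cos_int_2pin[of "\<lfloor>x\<rfloor>"] sin_int_2pin[of "\<lfloor>x\<rfloor>"]
    by (simp only: cos_add mult.commute[of "of_int _"] mult_1_right mult_zero_right diff_zero)
  then show ?thesis using cos_abs_real[of "2 * pi * (frac x - c)"] by (simp add: abs_mult)
qed

text \<open>
  An interval and its complement are both contained in closed arcs whose lengths add up to one, so
  the upper bound for both arcs pins down the frequency.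
\<close>
lemma interval_frequency:
  assumes ab: "0 \<le> a" "a < b" "b \<le> 1" "b - a < 1"
  shows "average (\<lambda>x. of_bool (frac x \<in> {a..<b})) \<longlonglongrightarrow> b - a"
proof -
  define c s where "c = (a + b) / 2" and "s = (b - a) / 2"
  have s: "0 < s" "s < 1/2" "s \<le> c" "c \<le> 1 - s"
    using ab by (auto simp: s_def c_def field_simps)
  let ?f = "\<lambda>x. of_bool (frac x \<in> {a..<b}) :: real"
  have inside: "?f x \<le> of_bool (cos (2 * pi * (x - c)) \<ge> cos (2 * pi * s))" for x
  proof (cases "frac x \<in> {a..<b}")
    case True
    then have "\<bar>frac x - c\<bar> \<le> s" by (auto simp: s_def c_def abs_if field_simps)
    then have "cos (2 * pi * s) \<le> cos (2 * pi * \<bar>frac x - c\<bar>)"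
      using s by (intro cos_monotone_0_pi_le) auto
    then show ?thesis by (simp add: cos_two_pi_frac)
  next
    case False
    then have "?f x = 0" by (simp del: atLeastLessThan_iff)
    also have "0 \<le> (of_bool (cos (2 * pi * (x - c)) \<ge> cos (2 * pi * s)) :: real)" by simp
    finally show ?thesis .
  qed
  \<comment> \<open>The complement is contained in the arc around the antipodal centre.\<close>
  have outside: "1 - ?f x \<le> of_bool (cos (2 * pi * (x - (c + 1/2))) \<ge> cos (2 * pi * (1/2 - s)))" for x
  proof (cases "frac x \<in> {a..<b}")
    case False
    define d where "d = \<bar>frac x - c\<bar>"
    have "s \<le> d" using False by (auto simp: s_def c_def d_def abs_if field_simps)
    moreover have "d \<le> 1 - s" unfolding d_def using frac_ge_0[of x] frac_lt_1[of x] s by linarith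
    ultimately have "\<bar>1/2 - d\<bar> \<le> 1/2 - s" by auto
    then have "cos (2 * pi * (1/2 - s)) \<le> cos (2 * pi * \<bar>1/2 - d\<bar>)"
      using s by (intro cos_monotone_0_pi_le) auto
    also have "\<dots> = cos (2 * pi * (1/2 - d))"
      using cos_abs_real[of "2 * pi * (1/2 - d)"] by (simp only: abs_mult) simp
    also have "\<dots> = - cos (2 * pi * d)" by (simp add: right_diff_distrib cos_diff)
    also have "\<dots> = cos (2 * pi * (x - c) - pi)" by (simp add: cos_two_pi_frac d_def cos_diff)
    also have "2 * pi * (x - c) - pi = 2 * pi * (x - (c + 1/2))" by (simp add: algebra_simps)
    finally show ?thesis by simp
  next
    case True
    then have "?f x = 1" by (simp del: atLeastLessThan_iff)
    then show ?thesis by simp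
  qed
  show ?thesis
  proof (rule tendstoI)
    fix e :: real assume e: "e > 0"
    have "\<forall>\<^sub>F N in sequentially. average (\<lambda>x. of_bool (cos (2 * pi * (x - c)) \<ge> cos (2 * pi * s))) N \<le> 2 * s + e / 2"
      using s e by (intro arc_frequency_upper) auto
    moreover have "\<forall>\<^sub>F N in sequentially. average (\<lambda>x. of_bool (cos (2 * pi * (x - (c + 1/2))) \<ge> cos (2 * pi * (1/2 - s)))) N
      \<le> 2 * (1/2 - s) + e / 2"
      using s e by (intro arc_frequency_upper) auto
    ultimately show "\<forall>\<^sub>F N in sequentially. dist (average ?f N) (b - a) < e"
      using eventually_gt_at_top[of "0::nat"]
    proof eventually_elim
      case (elim N)
      define A where "A = average ?f N"
      have "A \<le> 2 * s + e / 2"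
        unfolding A_def using average_mono[of ?f, OF inside] elim(1) by (rule order_trans)
      moreover have "1 - A \<le> 2 * (1/2 - s) + e / 2"
      proof -
        have "1 - A = average (\<lambda>x. 1 - ?f x) N"
          using elim(3) by (simp add: A_def average_def sum_subtractf diff_divide_distrib)
        also have "\<dots> \<le> 2 * (1/2 - s) + e / 2"
          using average_mono[of "\<lambda>x. 1 - ?f x", OF outside] elim(2) by (rule order_trans)
        finally show ?thesis .
      qed
      moreover have "b - a = 2 * s" by (simp add: s_def)
      ultimately have "\<bar>A - (b - a)\<bar> < e" using e by (simp add: abs_less_iff right_diff_distrib)
      then show ?case by (simp only: A_def dist_real_def)
    qed
  qed
qed

end

definition word_value :: "nat \<Rightarrow> nat list \<Rightarrow> nat" where
  "word_value D w = foldl (\<lambda>a d. a * D + d) 0 w"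

lemma word_value_less:
  assumes "set w \<subseteq> {..<D}"
  shows "word_value D w < D ^ length w"
  using assms
proof (induction w rule: rev_induct)
  case (snoc d w)
  then have "word_value D w + 1 \<le> D ^ length w" by simp
  then have "(word_value D w + 1) * D \<le> D ^ length w * D" by (rule mult_right_mono) simp
  then show ?case using snoc.prems by (simp add: word_value_def mult.commute)
qed (simp add: word_value_def)

text \<open>
  The last digit is the remainder modulo \<^term>\<open>D\<close> and the earlier ones form the quotient, which turns a
  pattern of digits into one congruence modulo a power of \<^term>\<open>D\<close>.
\<close>
lemma digits_eq_word_iff:
  assumes D: "D \<ge> 2" and w: "set w \<subseteq> {..<D}"
  shows "(\<forall>j<length w. base_digit D y j = w ! j) \<longleftrightarrow>
    \<lfloor>real D ^ length w * y\<rfloor> mod int D ^ length w = int (word_value D w)"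
  using w
proof (induction w rule: rev_induct)
  case (snoc d w)
  define q where "q = \<lfloor>real D ^ Suc (length w) * y\<rfloor>"
  have "\<lfloor>real D ^ length w * y\<rfloor> = \<lfloor>(real D ^ Suc (length w) * y) / real_of_int (int D)\<rfloor>"
    using D by simp
  also have "\<dots> = q div int D"
    unfolding q_def by (rule floor_divide_real_eq_div) simp
  finally have floor_div: "\<lfloor>real D ^ length w * y\<rfloor> = q div int D" .
  have d: "d < D" using snoc.prems by simp
  have "(\<forall>j<length (w @ [d]). base_digit D y j = (w @ [d]) ! j) \<longleftrightarrow>
      (\<forall>j<length w. base_digit D y j = w ! j) \<and> base_digit D y (length w) = d"
    by (auto simp: nth_append less_Suc_eq)
  also have "\<dots> \<longleftrightarrow> (q div int D) mod int D ^ length w = int (word_value D w) \<and> q mod int D = int d"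
    using snoc D by (simp only: floor_div base_digit_def q_def[symmetric] nat_eq_iff) auto
  also have "\<dots> \<longleftrightarrow> q mod int D ^ length (w @ [d]) = int (word_value D (w @ [d]))"
  proof -
    let ?A = "(q div int D) mod int D ^ length w" and ?v = "int (word_value D w)" and ?r = "q mod int D"
    have "q mod int D ^ length (w @ [d]) = int D * ?A + ?r"
      using D by (simp add: zmod_zmult2_eq)
    moreover have "int (word_value D (w @ [d])) = int D * ?v + int d"
      by (simp add: word_value_def mult.commute)
    moreover have "int D * ?A + ?r = int D * ?v + int d \<longleftrightarrow> ?A = ?v \<and> ?r = int d"
    proof
      assume eq: "int D * ?A + ?r = int D * ?v + int d"
      have r: "0 \<le> ?r" "?r < int D" using D by auto
      have "(int D * ?A + ?r) div int D = ?A" using r by simp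
      moreover have "(int D * ?v + int d) div int D = ?v" using d by simp
      ultimately have "?A = ?v" using eq by simp
      then show "?A = ?v \<and> ?r = int d" using eq by simp
    qed simp
    ultimately show ?thesis by (simp only: conj_commute)
  qed
  finally show ?case by (simp add: q_def)
qed (simp add: word_value_def)

lemma floor_mod_eq_iff_frac:
  fixes M v :: nat
  assumes v: "v < M"
  shows "\<lfloor>real M * y\<rfloor> mod int M = int v \<longleftrightarrow> frac y \<in> {real v / real M..<real (v + 1) / real M}"
proof -
  have M: "M > 0" using v by simp
  have "real M * y = real M * frac y + of_int (int M * \<lfloor>y\<rfloor>)"
    by (simp add: frac_def algebra_simps)
  then have "\<lfloor>real M * y\<rfloor> = \<lfloor>real M * frac y\<rfloor> + int M * \<lfloor>y\<rfloor>" by (simp only: floor_add_int)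
  moreover have "0 \<le> \<lfloor>real M * frac y\<rfloor>" by (simp add: frac_ge_0)
  moreover have "\<lfloor>real M * frac y\<rfloor> < int M"
    using M frac_lt_1[of y] by (simp add: floor_less_iff)
  ultimately have "\<lfloor>real M * y\<rfloor> mod int M = \<lfloor>real M * frac y\<rfloor>" by simp
  then show ?thesis using M by (auto simp: floor_eq_iff field_simps)
qed

lemma normal_to_base_if_weyl:
  assumes D: "D \<ge> 2" and "weyl_sequence (\<lambda>n. real D ^ n * x)"
  shows "normal_to_base D x"
  unfolding normal_to_base_def
proof (intro allI impI)
  interpret weyl_sequence "\<lambda>n. real D ^ n * x" by fact
  fix w assume w: "set w \<subseteq> {..<D}"
  let ?L = "length w" and ?v = "word_value D w"
  have shift: "base_digit D x (m + j) = base_digit D (real D ^ m * x) j" for m j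
    by (simp add: base_digit_def power_add mult_ac)
  have occ: "(\<forall>j<?L. base_digit D x (m + j) = w ! j) \<longleftrightarrow>
      frac (real D ^ m * x) \<in> {real ?v / real (D ^ ?L)..<real (?v + 1) / real (D ^ ?L)}" for m
    unfolding shift digits_eq_word_iff[OF D w]
    using floor_mod_eq_iff_frac[OF word_value_less[OF w], of "real D ^ m * x"] by simp
  have freq: "real (card {m. m < N \<and> (\<forall>j<?L. base_digit D x (m + j) = w ! j)}) / real N =
      average (\<lambda>x. of_bool (frac x \<in> {real ?v / real (D ^ ?L)..<real (?v + 1) / real (D ^ ?L)})) N" for N
  proof -
    have "{m. m < N \<and> (\<forall>j<?L. base_digit D x (m + j) = w ! j)} =
       {..<N} \<inter> {m. frac (real D ^ m * x) \<in> {real ?v / real (D ^ ?L)..<real (?v + 1) / real (D ^ ?L)}}"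
      unfolding occ by blast
    then show ?thesis unfolding average_def by (simp only: sum_of_bool_eq finite_lessThan)
  qed
  show "(\<lambda>N. real (card {m. m < N \<and> (\<forall>j<?L. base_digit D x (m + j) = w ! j)}) / real N)
          \<longlonglongrightarrow> 1 / real D ^ ?L"
  proof (cases "?L = 0")
    case True
    then have "\<forall>\<^sub>F N in sequentially. real (card {m. m < N \<and> (\<forall>j<?L. base_digit D x (m + j) = w ! j)}) / real N = 1"
      using eventually_gt_at_top[of "0::nat"] by (auto elim!: eventually_mono)
    then show ?thesis using True by (simp add: tendsto_eventually)
  next
    case False
    have DL: "D ^ ?L \<ge> 2" using self_le_power[of D ?L] D False by linarith
    have v: "?v + 1 \<le> D ^ ?L" using word_value_less[OF w] by simp
    have diff: "real (?v + 1) / real (D ^ ?L) - real ?v / real (D ^ ?L) = 1 / real (D ^ ?L)"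
      by (simp add: diff_divide_distrib[symmetric])
    have "average (\<lambda>x. of_bool (frac x \<in> {real ?v / real (D ^ ?L)..<real (?v + 1) / real (D ^ ?L)}))
      \<longlonglongrightarrow> real (?v + 1) / real (D ^ ?L) - real ?v / real (D ^ ?L)"
    proof (rule interval_frequency)
      show "0 \<le> real ?v / real (D ^ ?L)" by simp
      show "real ?v / real (D ^ ?L) < real (?v + 1) / real (D ^ ?L)"
        using D by (intro divide_strict_right_mono) auto
      show "real (?v + 1) / real (D ^ ?L) \<le> 1"
        using v D by (subst divide_le_eq_1_pos) (simp_all only: of_nat_le_iff of_nat_0_less_iff zero_less_power)
      have "2 \<le> real (D ^ ?L)" using DL by (metis of_nat_le_iff of_nat_numeral)
      then have "1 / real (D ^ ?L) \<le> 1 / 2" using D by (intro divide_left_mono) simp_all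
      then show "real (?v + 1) / real (D ^ ?L) - real ?v / real (D ^ ?L) < 1" unfolding diff by linarith
    qed
    then show ?thesis unfolding freq diff by simp
  qed
qed

section \<open>Ternary mantissas of powers\<close>

text \<open>
  Division by \<^term>\<open>R\<close> is injective on such a set.
\<close>
lemma card_separated_le:
  fixes A :: "nat set"
  assumes "A \<subseteq> {..<N}" "R > 0" and sep: "\<And>m n. m \<in> A \<Longrightarrow> n \<in> A \<Longrightarrow> m < n \<Longrightarrow> m + R \<le> n"
  shows "real (card A) \<le> real N / real R + 1"
proof -
  have "inj_on (\<lambda>n. n div R) A"
  proof (rule linorder_inj_onI')
    fix m n assume "m \<in> A" "n \<in> A" "m < n"
    then have "(m + R) div R \<le> n div R" using sep by (intro div_le_mono) auto
    then show "m div R \<noteq> n div R" using \<open>R > 0\<close> by simp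
  qed
  moreover have "(\<lambda>n. n div R) ` A \<subseteq> {..N div R}"
    using assms(1) by (auto intro!: div_le_mono)
  ultimately have "card A \<le> card {..N div R}"
    by (intro card_inj_on_le[where f = "\<lambda>n. n div R"]) auto
  then have "real (card A) \<le> real (N div R) + 1" by simp
  also have "real (N div R) \<le> real N / real R" by (rule of_nat_div_le_of_nat)
  finally show ?thesis by simp
qed

text \<open>
  The exponent \<open>s\<close> for which \<open>3\<^sup>s\<close> has the size of \<open>D\<^sup>n\<close>: multiplication by \<open>D\<^sup>n\<close> brings the ternary
  digits with index near \<open>s\<close> to the decisive place around the radix point.
\<close>
definition ternary_scale :: "nat \<Rightarrow> nat \<Rightarrow> nat" where
  "ternary_scale D n = (GREATEST k. 3 ^ k \<le> D ^ n)"

definition mantissa3 :: "nat \<Rightarrow> nat \<Rightarrow> real" where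
  "mantissa3 D n = real D ^ n / 3 ^ ternary_scale D n"

lemma ternary_scale_bounds:
  assumes "D \<ge> 2"
  shows "3 ^ ternary_scale D n \<le> D ^ n" "D ^ n < 3 ^ Suc (ternary_scale D n)"
proof -
  have bound: "k \<le> D ^ n" if "3 ^ k \<le> D ^ n" for k :: nat
  proof -
    have "k < 3 ^ k" by (rule power_gt_expt) simp
    then show ?thesis using that by linarith
  qed
  have ex: "3 ^ (0::nat) \<le> D ^ n" using assms by simp
  show "3 ^ ternary_scale D n \<le> D ^ n"
    unfolding ternary_scale_def using GreatestI_nat[where P = "\<lambda>k. 3 ^ k \<le> D ^ n", OF ex bound] by blast
  show "D ^ n < 3 ^ Suc (ternary_scale D n)"
  proof (rule ccontr)
    assume "\<not> ?thesis"
    then have "3 ^ Suc (ternary_scale D n) \<le> D ^ n" by simp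
    then have "Suc (ternary_scale D n) \<le> ternary_scale D n"
      unfolding ternary_scale_def
      using Greatest_le_nat[where P = "\<lambda>k. 3 ^ k \<le> D ^ n", OF _ bound] by blast
    then show False by simp
  qed
qed

lemma ternary_scale_unique:
  assumes "D \<ge> 2" "3 ^ k \<le> D ^ n" "D ^ n < 3 ^ Suc k"
  shows "ternary_scale D n = k"
proof -
  have "(3::nat) ^ k < 3 ^ Suc (ternary_scale D n)" "(3::nat) ^ ternary_scale D n < 3 ^ Suc k"
    using assms ternary_scale_bounds[OF assms(1), of n] by linarith+
  then have "k < Suc (ternary_scale D n)" "ternary_scale D n < Suc k"
    by (auto intro: power_less_imp_less_exp[of "3::nat"] simp del: power_Suc)
  then show ?thesis by simp
qed

lemma ternary_scale_mono:
  assumes "D \<ge> 2" "m \<le> n"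
  shows "ternary_scale D m \<le> ternary_scale D n"
proof -
  have "D ^ m \<le> D ^ n" using assms by (intro power_increasing) auto
  then have "(3::nat) ^ ternary_scale D m < 3 ^ Suc (ternary_scale D n)"
    using ternary_scale_bounds[OF assms(1)] by (meson le_less_trans)
  then have "ternary_scale D m < Suc (ternary_scale D n)"
    by (rule power_less_imp_less_exp[rotated]) simp
  then show ?thesis by simp
qed

text \<open>
  Two steps multiply by \<open>D\<^sup>2 \<ge> 4 > 3\<close>. This bounds how long the digit windows of two powers of \<^term>\<open>D\<close>
  can overlap.
\<close>
lemma ternary_scale_growth:
  assumes "D \<ge> 2"
  shows "ternary_scale D m + j \<le> ternary_scale D (m + 2 * j)"
proof (induction j)
  case (Suc j)
  let ?n = "m + 2 * j"
  have "4 \<le> D ^ 2" using power_mono[of 2 D 2] assms by simp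
  then have "3 ^ Suc (ternary_scale D ?n) \<le> D ^ 2 * D ^ ?n"
    using ternary_scale_bounds(1)[OF assms, of ?n] by (auto intro: mult_mono)
  also have "\<dots> = D ^ (m + 2 * Suc j)" by (simp add: power_add power2_eq_square)
  also have "\<dots> < 3 ^ Suc (ternary_scale D (m + 2 * Suc j))"
    by (rule ternary_scale_bounds(2)[OF assms])
  finally have "Suc (ternary_scale D ?n) < Suc (ternary_scale D (m + 2 * Suc j))"
    by (rule power_less_imp_less_exp[rotated]) simp
  then show ?case using Suc by simp
qed simp

lemma mantissa3_bounds:
  assumes "D \<ge> 2"
  shows "1 \<le> mantissa3 D n" "mantissa3 D n < 3"
proof -
  have "real (3 ^ ternary_scale D n) \<le> real (D ^ n)"
    using ternary_scale_bounds(1)[OF assms] of_nat_le_iff by blast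
  then show "1 \<le> mantissa3 D n" by (simp add: mantissa3_def)
  have "real (D ^ n) < real (3 ^ Suc (ternary_scale D n))"
    using ternary_scale_bounds(2)[OF assms] of_nat_less_iff by blast
  then show "mantissa3 D n < 3" by (simp add: mantissa3_def field_simps)
qed

lemma mantissa3_rational: "mantissa3 D n \<in> \<rat>"
  by (simp add: mantissa3_def)

text \<open>
  A ratio of two mantissas is \<open>D\<^sup>j / 3\<^sup>i\<close> with \<open>j < R\<close>; as mantissas are between 1 and 3, the exponent
  \<open>i\<close> is bounded in terms of \<open>j\<close>.
\<close>
lemma mantissa3_ratio_finite:
  assumes D: "D \<ge> 2"
  shows "\<exists>T. finite T \<and> T \<subseteq> {real D ^ j / 3 ^ i |i j. 0 < j} \<and>
    (\<forall>m n. m < n \<and> n < m + R \<longrightarrow> mantissa3 D n / mantissa3 D m \<in> T)"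
proof (intro exI conjI allI impI)
  let ?T = "(\<lambda>(i, j). real D ^ j / 3 ^ i) ` ({..3 * D ^ R} \<times> {0<..<R})"
  show "finite ?T" by simp
  show "?T \<subseteq> {real D ^ j / 3 ^ i |i j. 0 < j}" by (force simp del: of_nat_power)
  fix m n assume mn: "m < n \<and> n < m + R"
  define i where "i = ternary_scale D n - ternary_scale D m"
  define j where "j = n - m"
  have n: "n = m + j" and j: "0 < j" "j < R" using mn by (auto simp: j_def)
  have k: "ternary_scale D n = ternary_scale D m + i"
    using ternary_scale_mono[OF D, of m n] mn by (simp add: i_def)
  have eq: "mantissa3 D n / mantissa3 D m = real D ^ j / 3 ^ i"
    using D k by (simp add: mantissa3_def n power_add)
  have "3 ^ ternary_scale D m * 3 ^ i \<le> D ^ m * D ^ j"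
    using ternary_scale_bounds(1)[OF D, of n] using k by (simp add: n power_add)
  also have "\<dots> \<le> (3 * 3 ^ ternary_scale D m) * D ^ j"
    using ternary_scale_bounds(2)[OF D, of m] by (intro mult_right_mono) auto
  finally have "3 ^ i \<le> 3 * D ^ j" by simp
  also have "\<dots> \<le> 3 * D ^ R" using D j by (intro mult_left_mono power_increasing) auto
  finally have "(3::nat) ^ i \<le> 3 * D ^ R" .
  moreover have "i < 3 ^ i" by (rule power_gt_expt) simp
  ultimately have "i \<le> 3 * D ^ R" by linarith
  then show "mantissa3 D n / mantissa3 D m \<in> ?T"
    unfolding eq using j by (intro image_eqI[of _ _ "(i, j)"]) auto
qed

lemma mantissa3_periodic_finite_range:
  assumes D: "D \<ge> 2" and j: "0 < j" "D ^ j = 3 ^ i"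
  shows "finite (range (mantissa3 D))"
proof -
  have per: "mantissa3 D (n + j) = mantissa3 D n" for n
  proof -
    have "ternary_scale D (n + j) = ternary_scale D n + i"
      using ternary_scale_bounds[OF D, of n]
      by (intro ternary_scale_unique[OF D]) (auto simp: power_add j(2))
    moreover have "real D ^ j = 3 ^ i" using j(2) by (metis of_nat_numeral of_nat_power)
    ultimately show ?thesis by (simp add: mantissa3_def power_add)
  qed
  have "mantissa3 D n = mantissa3 D (n mod j)" for n
  proof (induction n rule: less_induct)
    case (less n)
    show ?case
    proof (cases "n < j")
      case False
      then have "mantissa3 D n = mantissa3 D (n - j)" using per[of "n - j"] by simp
      also have "\<dots> = mantissa3 D ((n - j) mod j)" using less False j(1) by simp
      also have "(n - j) mod j = n mod j" using False by (simp add: le_mod_geq)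
      finally show ?thesis .
    qed simp
  qed
  then have "mantissa3 D n \<in> mantissa3 D ` {..<j}" for n
    using j(1) by (metis image_eqI lessThan_iff mod_less_divisor)
  then have "range (mantissa3 D) \<subseteq> mantissa3 D ` {..<j}" by blast
  then show ?thesis using finite_surj by blast
qed

text \<open>
  If no positive power of \<^term>\<open>D\<close> is a power of 3, the ratios of mantissas less than \<open>R\<close> steps apart form a
  finite set without 1, so two visits to a short interval are at least \<open>R\<close> steps apart. Otherwise the
  mantissas are periodic, and a point that is not among their finitely many values has a neighbourhood
  that is never visited.
\<close>
lemma mantissa3_no_atom:
  assumes D: "D \<ge> 2" and e: "e \<notin> range (mantissa3 D)" and \<epsilon>: "\<epsilon> > 0"
  shows "\<exists>U. open U \<and> e \<in> U \<and>
    (\<forall>N. real (card {n. n < N \<and> mantissa3 D n \<in> U}) \<le> \<epsilon> * real N + 1)"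
proof (cases "\<exists>j i. 0 < j \<and> D ^ j = 3 ^ i")
  case True
  then obtain j i where "0 < j" "D ^ j = 3 ^ i" by (elim exE conjE)
  then have "closed (range (mantissa3 D))"
    by (intro finite_imp_closed mantissa3_periodic_finite_range[OF D])
  then have "open (- range (mantissa3 D))" by (rule open_Compl)
  moreover have "e \<in> - range (mantissa3 D)" using e by simp
  moreover have "real (card {n. n < N \<and> mantissa3 D n \<in> - range (mantissa3 D)}) \<le> \<epsilon> * real N + 1" for N
    using \<epsilon> by simp
  ultimately show ?thesis by blast
next
  case False
  obtain R0 where R0: "1 / real (Suc R0) < \<epsilon>" by (rule nat_approx_posE[OF \<epsilon>])
  define R where "R = Suc R0"
  obtain T where T: "finite T" "T \<subseteq> {real D ^ j / 3 ^ i |i j. 0 < j}"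
    "\<And>m n. m < n \<Longrightarrow> n < m + R \<Longrightarrow> mantissa3 D n / mantissa3 D m \<in> T"
    using mantissa3_ratio_finite[OF D, of R] by blast
  have "1 \<notin> T"
  proof
    assume "1 \<in> T"
    then obtain i j where "0 < j" "1 = real D ^ j / 3 ^ i" using T(2) by blast
    then have "real (D ^ j) = real (3 ^ i)" by (simp add: field_simps)
    then have "D ^ j = 3 ^ i" by (simp only: of_nat_eq_iff)
    then show False using False \<open>0 < j\<close> by blast
  qed
  obtain \<delta> where \<delta>: "\<delta> > 0" "\<And>t. t \<in> T \<Longrightarrow> t \<noteq> 1 \<Longrightarrow> \<delta> \<le> dist 1 t"
    using finite_set_avoid[OF T(1), of "1::real"] by blast
  have count: "real (card {n. n < N \<and> mantissa3 D n \<in> ball e (\<delta> / 2)}) \<le> \<epsilon> * real N + 1" for N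
  proof -
    have "real (card {n. n < N \<and> mantissa3 D n \<in> ball e (\<delta> / 2)}) \<le> real N / real R + 1" (is "real (card ?A) \<le> _")
    proof (rule card_separated_le)
      fix m n assume "m \<in> ?A" "n \<in> ?A" and "m < n"
      then have "dist e (mantissa3 D m) < \<delta> / 2" "dist e (mantissa3 D n) < \<delta> / 2"
        by simp_all
      then have "dist (mantissa3 D m) (mantissa3 D n) < \<delta>"
        by (rule dist_triangle_half_r)
      moreover have "\<bar>1 - mantissa3 D n / mantissa3 D m\<bar> \<le> \<bar>mantissa3 D m - mantissa3 D n\<bar>"
      proof -
        have "1 - mantissa3 D n / mantissa3 D m = (mantissa3 D m - mantissa3 D n) / mantissa3 D m"
          using mantissa3_bounds(1)[OF D, of m] by (simp add: field_simps)
        then show ?thesis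
          using mantissa3_bounds(1)[OF D, of m]
            divide_left_mono[of 1 "mantissa3 D m" "\<bar>mantissa3 D m - mantissa3 D n\<bar>"] by simp
      qed
      ultimately have "dist 1 (mantissa3 D n / mantissa3 D m) < \<delta>"
        by (simp add: dist_real_def)
      then have "mantissa3 D n / mantissa3 D m \<notin> T" using \<delta>(2) \<open>1 \<notin> T\<close> by (metis linorder_not_less)
      then show "m + R \<le> n" using T(3)[OF \<open>m < n\<close>] linorder_not_less by blast
    next
      show "{n. n < N \<and> mantissa3 D n \<in> ball e (\<delta> / 2)} \<subseteq> {..<N}" by blast
      show "0 < R" by (simp add: R_def)
    qed
    moreover have "real N / real R \<le> \<epsilon> * real N"
      using mult_right_mono[of "1 / real R" \<epsilon> "real N"] R0 by (simp add: R_def)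
    ultimately show ?thesis by linarith
  qed
  show ?thesis
  proof (intro exI conjI allI)
    show "e \<in> ball e (\<delta> / 2)" using \<delta>(1) by simp
  qed (rule open_ball count)+
qed

section \<open>Averages that are small off a countable set\<close>

text \<open>
  Around a point of \<^term>\<open>E\<close> there is a rarely visited neighbourhood, where the bound by 1 is good
  enough; the allowed frequencies are taken from a geometric series along an enumeration of \<^term>\<open>E\<close>.
  Around every other point of \<^term>\<open>S\<close> some \<open>G l\<close> is already small. Finitely many of these
  neighbourhoods cover \<^term>\<open>S\<close>, and monotonicity in \<open>l\<close> allows one common \<open>l\<close>.
\<close>
lemma average_small_off_countable:
  fixes y :: "nat \<Rightarrow> 'a::topological_space" and G :: "nat \<Rightarrow> 'a \<Rightarrow> real"
  assumes S: "compact S" "\<And>n. y n \<in> S"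
    and E: "countable E"
    and no_atom: "\<And>e \<epsilon>. e \<in> E \<Longrightarrow> \<epsilon> > 0 \<Longrightarrow> \<exists>U. open U \<and> e \<in> U \<and>
      (\<forall>N. real (card {n. n < N \<and> y n \<in> U}) \<le> \<epsilon> * real N + 1)"
    and cont: "\<And>l. continuous_on UNIV (G l)"
    and le1: "\<And>l t. G l t \<le> 1"
    and dec: "\<And>l t. G (Suc l) t \<le> G l t"
    and lim: "\<And>t. t \<in> S \<Longrightarrow> t \<notin> E \<Longrightarrow> (\<lambda>l. G l t) \<longlonglongrightarrow> 0"
    and \<epsilon>: "\<epsilon> > 0"
  shows "\<exists>L B. \<forall>l\<ge>L. \<forall>N. (\<Sum>n<N. G l (y n)) \<le> \<epsilon> * real N + B"
proof -
  have Gmono: "G l' t \<le> G l t" if "l \<le> l'" for l l' t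
    using that by (rule lift_Suc_antimono_le[where f = "\<lambda>l. G l t", rotated]) (rule dec)
  define idx where "idx = to_nat_on E"
  \<comment> \<open>The frequency that is granted to the exceptional point \<open>e\<close>; all of them together use up \<open>\<epsilon> / 2\<close>.\<close>
  define w where "w e = \<epsilon> / 2 * (1 / 2) ^ Suc (idx e)" for e
  have w_pos: "w e > 0" for e using \<epsilon> by (simp add: w_def)
  define nbhd where "nbhd t U l \<longleftrightarrow> open U \<and> t \<in> U \<and>
     (t \<in> E \<longrightarrow> (\<forall>N. real (card {n. n < N \<and> y n \<in> U}) \<le> w t * real N + 1)) \<and>
     (t \<notin> E \<longrightarrow> (\<forall>u\<in>U. G l u < \<epsilon> / 2))" for t U l
  have "\<exists>U l. nbhd t U l" if t: "t \<in> S" for t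
  proof (cases "t \<in> E")
    case True
    then show ?thesis using no_atom[OF True w_pos] by (auto simp: nbhd_def)
  next
    case False
    have "eventually (\<lambda>l. G l t < \<epsilon> / 2) sequentially"
      using order_tendstoD(2)[OF lim[OF t False], of "\<epsilon> / 2"] \<epsilon> by simp
    then obtain l where l: "G l t < \<epsilon> / 2" by (auto simp: eventually_sequentially)
    have "open {u. G l u < \<epsilon> / 2}"
      using cont[of l] by (intro open_Collect_less) (auto intro: continuous_intros)
    then have "nbhd t {u. G l u < \<epsilon> / 2} l" using False l by (auto simp: nbhd_def)
    then show ?thesis by blast
  qed
  then obtain U l where Ul: "\<And>t. t \<in> S \<Longrightarrow> nbhd t (U t) (l t)" by metis
  have Uopen: "\<And>t. t \<in> S \<Longrightarrow> open (U t)" and Uin: "\<And>t. t \<in> S \<Longrightarrow> t \<in> U t"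
    and UE: "\<And>t N. t \<in> S \<Longrightarrow> t \<in> E \<Longrightarrow> real (card {n. n < N \<and> y n \<in> U t}) \<le> w t * real N + 1"
    and UG: "\<And>t u. t \<in> S \<Longrightarrow> t \<notin> E \<Longrightarrow> u \<in> U t \<Longrightarrow> G (l t) u < \<epsilon> / 2"
    using Ul unfolding nbhd_def by blast+
  obtain F where F: "F \<subseteq> S" "finite F" "S \<subseteq> (\<Union>t\<in>F. U t)"
  proof (rule compactE_image[OF S(1), of S U])
    show "S \<subseteq> (\<Union>t\<in>S. U t)" using Uin by blast
  qed (use Uopen in auto)
  define FE where "FE = F \<inter> E"
  have FE: "finite FE" using F by (simp add: FE_def)
  define L where "L = Max (insert 0 (l ` F))"
  have L: "l t \<le> L" if "t \<in> F" for t using that F(2) by (auto simp: L_def)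
  have "(\<Sum>n<N. G l' (y n)) \<le> \<epsilon> * real N + real (card FE)" if l': "l' \<ge> L" for l' N
  proof -
    let ?bad = "\<lambda>e. {n. n < N \<and> y n \<in> U e}"
    have pt: "G l' (y n) \<le> \<epsilon> / 2 + (\<Sum>e\<in>FE. of_bool (n \<in> ?bad e))" if n: "n < N" for n
    proof -
      have nonneg: "(\<Sum>e\<in>FE. of_bool (n \<in> ?bad e)) \<ge> (0::real)" by (intro sum_nonneg) auto
      obtain t where t: "t \<in> F" "y n \<in> U t" using F(3) S(2) by blast
      show ?thesis
      proof (cases "t \<in> E")
        case True
        have "(1::real) \<le> (\<Sum>e\<in>FE. of_bool (n \<in> ?bad e))"
          using member_le_sum[of t FE "\<lambda>e. of_bool (n \<in> ?bad e) :: real"] FE t True n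
          by (auto simp: FE_def)
        then show ?thesis using le1[of l' "y n"] \<epsilon> by linarith
      next
        case False
        have "G l' (y n) \<le> G (l t) (y n)" using L[OF t(1)] l' by (intro Gmono) auto
        also have "\<dots> < \<epsilon> / 2" using UG F(1) t False by blast
        finally show ?thesis using nonneg by linarith
      qed
    qed
    have sum_w: "(\<Sum>e\<in>FE. w e) \<le> \<epsilon> / 2"
    proof -
      have inj: "inj_on idx FE"
        using inj_on_to_nat_on[OF E] unfolding idx_def FE_def by (rule inj_on_subset) auto
      have "(\<Sum>e\<in>FE. (1 / 2) ^ Suc (idx e)) = (\<Sum>i\<in>idx ` FE. (1 / 2 :: real) ^ Suc i)"
        by (simp add: sum.reindex[OF inj])
      also have "\<dots> \<le> (\<Sum>i. (1 / 2 :: real) ^ Suc i)"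
        using FE power_half_series by (intro sum_le_suminf) (auto simp: sums_iff)
      also have "\<dots> = 1" using power_half_series by (rule sums_unique[symmetric])
      finally show ?thesis using \<epsilon> unfolding w_def sum_distrib_left[symmetric] by simp
    qed
    have "(\<Sum>n<N. G l' (y n)) \<le> (\<Sum>n<N. \<epsilon> / 2 + (\<Sum>e\<in>FE. of_bool (n \<in> ?bad e)))"
      by (intro sum_mono pt) auto
    also have "\<dots> = \<epsilon> / 2 * real N + (\<Sum>n<N. \<Sum>e\<in>FE. of_bool (n \<in> ?bad e))"
      unfolding sum.distrib by (simp only: sum_constant card_lessThan mult.commute)
    also have "(\<Sum>n<N. \<Sum>e\<in>FE. of_bool (n \<in> ?bad e)) = (\<Sum>e\<in>FE. \<Sum>n<N. of_bool (n \<in> ?bad e) :: real)"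
      by (rule sum.swap)
    also have "(\<Sum>e\<in>FE. \<Sum>n<N. of_bool (n \<in> ?bad e)) = (\<Sum>e\<in>FE. real (card (?bad e)))"
    proof (intro sum.cong refl)
      fix e
      have "{..<N} \<inter> {n. n \<in> ?bad e} = ?bad e" by auto
      then show "(\<Sum>n<N. of_bool (n \<in> ?bad e)) = real (card (?bad e))"
        by (simp only: sum_of_bool_eq finite_lessThan)
    qed
    also have "\<dots> \<le> (\<Sum>e\<in>FE. w e * real N + 1)"
      using F(1) by (intro sum_mono UE) (auto simp: FE_def)
    also have "\<dots> = (\<Sum>e\<in>FE. w e) * real N + real (card FE)"
      by (simp add: sum.distrib sum_distrib_right)
    also have "\<dots> \<le> \<epsilon> / 2 * real N + real (card FE)"
      by (intro add_right_mono mult_right_mono sum_w) simp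
    finally show ?thesis by simp
  qed
  then show ?thesis by blast
qed

section \<open>Characteristic functions of digit blocks\<close>

text \<open>
  The characteristic function at \<^term>\<open>x\<close> of a coin that shows 1 with probability \<^term>\<open>p\<close> and 0
  otherwise.
\<close>
definition coin_char :: "real \<Rightarrow> real \<Rightarrow> complex" where
  "coin_char p x = of_real (1 - p) + of_real p * cis x"

lemma norm_coin_char_squared:
  "(cmod (coin_char p x))\<^sup>2 = 1 - 2 * p * (1 - p) * (1 - cos x)"
proof -
  have "(cmod (coin_char p x))\<^sup>2 = (1 - p + p * cos x)\<^sup>2 + (p * sin x)\<^sup>2"
    by (simp add: coin_char_def cmod_power2)
  also have "(p * sin x)\<^sup>2 = p\<^sup>2 * (1 - (cos x)\<^sup>2)"
    by (simp add: power_mult_distrib sin_squared_eq)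
  finally show ?thesis by (simp add: power2_eq_square algebra_simps)
qed

lemma norm_coin_char_le_1:
  assumes "0 \<le> p" "p \<le> 1"
  shows "cmod (coin_char p x) \<le> 1"
proof -
  have "0 \<le> 2 * p * (1 - p) * (1 - cos x)" using assms by simp
  then have "(cmod (coin_char p x))\<^sup>2 \<le> 1" unfolding norm_coin_char_squared by linarith
  then show ?thesis by (simp add: power_le_one_iff abs_square_le_1)
qed

lemma norm_coin_char_away:
  assumes "0 < p" "p < 1" "cos x < 1/2"
  shows "cmod (coin_char p x) \<le> sqrt (1 - p * (1 - p))"
proof (rule real_le_rsqrt)
  have "p * (1 - p) * 1 \<le> p * (1 - p) * (2 * (1 - cos x))"
    using assms by (intro mult_left_mono) auto
  then show "(cmod (coin_char p x))\<^sup>2 \<le> 1 - p * (1 - p)"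
    unfolding norm_coin_char_squared by (simp add: algebra_simps)
qed

text \<open>
  Tripling a small angle multiplies \<open>1 - cos\<close> by a factor of at least 4; this replaces the statement
  that the distance to the nearest integer triples.
\<close>
lemma cos_treble_gap: "1 - cos (3 * x) = (1 - cos x) * (1 + 2 * cos x)\<^sup>2" for x :: real
  unfolding cos_treble_cos by (simp add: power2_eq_square power3_eq_cube algebra_simps)

text \<open>
  As long as the cosine stays at least \<open>1/2\<close>, its gap to 1 grows at least by the factor 4 with every
  tripling. The gap is at most 2, so it must be zero from the start, and then some \<open>3\<^sup>j t\<close> is an
  integer.
\<close>
lemma tripling_reaches_far_half:
  assumes "\<And>j. 3 ^ j * t \<notin> \<int>"
  shows "\<exists>j\<ge>J. cos (2 * pi * (3 ^ j * t)) < 1/2"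
proof (rule ccontr)
  assume "\<not> ?thesis"
  then have near: "cos (2 * pi * (3 ^ j * t)) \<ge> 1/2" if "j \<ge> J" for j using that by (meson not_less)
  define u where "u j = 1 - cos (2 * pi * (3 ^ j * t))" for j
  have grow: "4 * u j \<le> u (Suc j)" if "j \<ge> J" for j
  proof -
    let ?c = "cos (2 * pi * (3 ^ j * t))"
    have "2 * pi * (3 ^ Suc j * t) = 3 * (2 * pi * (3 ^ j * t))" by simp
    then have "u (Suc j) = u j * (1 + 2 * ?c)\<^sup>2"
      unfolding u_def by (simp only: cos_treble_gap)
    moreover have "2\<^sup>2 \<le> (1 + 2 * ?c)\<^sup>2" using near[OF that] by (intro power_mono) auto
    moreover have "u j \<ge> 0" by (simp add: u_def)
    ultimately show ?thesis using mult_left_mono[of 4 "(1 + 2 * ?c)\<^sup>2" "u j"] by (simp add: mult.commute)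
  qed
  have pow: "4 ^ i * u J \<le> u (J + i)" for i
  proof (induction i)
    case (Suc i)
    then show ?case using grow[of "J + i"] by simp
  qed simp
  have "u J > 0"
  proof -
    have "cos (2 * pi * (3 ^ J * t)) \<noteq> 1"
    proof
      assume "cos (2 * pi * (3 ^ J * t)) = 1"
      then obtain n :: int where "2 * pi * (3 ^ J * t) = of_int n * 2 * pi"
        using cos_one_2pi_int by blast
      then have "3 ^ J * t = of_int n" by simp
      then show False using assms[of J] by (metis Ints_of_int)
    qed
    moreover have "cos (2 * pi * (3 ^ J * t)) \<le> 1" by (rule cos_le_one)
    ultimately show ?thesis unfolding u_def by linarith
  qed
  moreover obtain i where "2 / u J < 4 ^ i" using real_arch_pow[of 4 "2 / u J"] by auto
  ultimately have "2 < 4 ^ i * u J" by (simp add: field_simps)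
  also have "\<dots> \<le> u (J + i)" by (rule pow)
  also have "\<dots> \<le> 2" using cos_ge_minus_one[of "2 * pi * (3 ^ (J + i) * t)"] unfolding u_def by linarith
  finally show False by simp
qed

text \<open>
  The modulus of the expectation of \<open>exp (2 \<pi> \<i> t N)\<close>, where \<open>N\<close> is the natural number with \<open>l\<close>
  independent ternary digits that are 1 with probability \<^term>\<open>p\<close> and 0 otherwise.
\<close>
definition damping :: "real \<Rightarrow> nat \<Rightarrow> real \<Rightarrow> real" where
  "damping p l t = (\<Prod>j<l. cmod (coin_char p (2 * pi * (3 ^ j * t))))"

lemma damping_nonneg: "0 \<le> damping p l t"
  unfolding damping_def by (intro prod_nonneg) auto

lemma damping_Suc: "damping p (Suc l) t = damping p l t * cmod (coin_char p (2 * pi * (3 ^ l * t)))"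
  by (simp add: damping_def)

lemma damping_decreasing:
  assumes "0 \<le> p" "p \<le> 1"
  shows "damping p (Suc l) t \<le> damping p l t"
  unfolding damping_Suc using damping_nonneg norm_coin_char_le_1[OF assms]
  by (intro mult_left_le) auto

lemma damping_le_1:
  assumes "0 \<le> p" "p \<le> 1"
  shows "damping p l t \<le> 1"
  unfolding damping_def using norm_coin_char_le_1[OF assms] by (intro prod_le_1) auto

text \<open>
  The product decreases to some limit. Infinitely often its next factor is at most a fixed number less
  than 1, which is impossible for a positive limit.
\<close>
lemma damping_tendsto_0:
  assumes p: "0 < p" "p < 1" and t: "\<And>j. 3 ^ j * t \<notin> \<int>"
  shows "(\<lambda>l. damping p l t) \<longlonglongrightarrow> 0"
proof -
  define \<rho> where "\<rho> = sqrt (1 - p * (1 - p))"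
  have pp: "0 < p * (1 - p)" "p * (1 - p) < 1"
    using p mult_strict_mono[of p 1 "1 - p" 1] by auto
  then have \<rho>: "0 < \<rho>" "\<rho> < 1" by (auto simp: \<rho>_def)
  have "decseq (\<lambda>l. damping p l t)" using damping_decreasing p by (auto simp: decseq_Suc_iff)
  then obtain L where L: "(\<lambda>l. damping p l t) \<longlonglongrightarrow> L" "\<And>l. L \<le> damping p l t"
    using decseq_convergent[of "\<lambda>l. damping p l t" 0] damping_nonneg by blast
  have "L \<ge> 0" using L(1) damping_nonneg by (intro LIMSEQ_le_const) auto
  moreover have "\<not> L > 0"
  proof
    assume "L > 0"
    then have "L < L / \<rho>" using \<rho> by (simp add: field_simps)
    then have "\<forall>\<^sub>F l in sequentially. damping p l t < L / \<rho>" using L(1) by (rule order_tendstoD(2)[rotated])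
    then obtain J where J: "\<And>l. l \<ge> J \<Longrightarrow> damping p l t < L / \<rho>" by (auto simp: eventually_sequentially)
    obtain j where j: "j \<ge> J" "cos (2 * pi * (3 ^ j * t)) < 1/2"
      using tripling_reaches_far_half[OF t] by blast
    have "damping p (Suc j) t \<le> damping p j t * \<rho>"
      unfolding damping_Suc \<rho>_def using norm_coin_char_away[OF p j(2)] damping_nonneg by (rule mult_left_mono)
    also have "\<dots> < L" using J[OF j(1)] \<rho> by (simp add: field_simps)
    finally show False using L(2)[of "Suc j"] by simp
  qed
  ultimately show ?thesis using L(1) by simp
qed

text \<open>
  The exceptional \<open>y\<close>, those for which \<open>a y\<close> has a finite ternary expansion, are countably many. As
  \<^term>\<open>a\<close> is irrational and mantissas are rational, no mantissa is exceptional.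
\<close>
lemma average_damping_small:
  assumes D: "D \<ge> 2" and p: "0 < p" "p < 1" and a: "a \<notin> \<rat>" and \<epsilon>: "\<epsilon> > 0"
  shows "\<exists>L B. \<forall>l\<ge>L. \<forall>N. (\<Sum>n<N. damping p l (a * mantissa3 D n)) \<le> \<epsilon> * real N + B"
proof (rule average_small_off_countable[where S = "{1..3}" and E = "{y. \<exists>j. 3 ^ j * (a * y) \<in> \<int>}"
      and y = "mantissa3 D" and G = "\<lambda>l y. damping p l (a * y)"])
  let ?E = "{y. \<exists>j. 3 ^ j * (a * y) \<in> \<int>}"
  have a0: "a \<noteq> 0" using a by auto
  have "?E \<subseteq> range (\<lambda>(j :: nat, k :: int). of_int k / (3 ^ j * a))"
  proof
    fix y assume "y \<in> ?E"
    then obtain j k where "3 ^ j * (a * y) = of_int k" by (auto elim!: Ints_cases)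
    then have "y = of_int k / (3 ^ j * a)" using a0 by (simp add: field_simps)
    then show "y \<in> range (\<lambda>(j :: nat, k :: int). of_int k / (3 ^ j * a))"
      by (intro image_eqI[of _ _ "(j, k)"]) simp_all
  qed
  then show "countable ?E" by (rule countable_subset) auto
  have irr: "mantissa3 D n \<notin> ?E" for n
  proof
    assume "mantissa3 D n \<in> ?E"
    then obtain j where j: "3 ^ j * (a * mantissa3 D n) \<in> \<int>" by blast
    have m: "mantissa3 D n \<in> \<rat>" "mantissa3 D n \<noteq> 0"
      using mantissa3_rational mantissa3_bounds(1)[OF D, of n] by auto
    have "3 ^ j * mantissa3 D n \<in> \<rat>" using m(1) by simp
    then have "3 ^ j * (a * mantissa3 D n) / (3 ^ j * mantissa3 D n) \<in> \<rat>"
      using j Ints_subset_Rats by (intro Rats_divide) blast+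
    moreover have "3 ^ j * (a * mantissa3 D n) / (3 ^ j * mantissa3 D n) = a" using m(2) by simp
    ultimately show False using a by simp
  qed
  show "\<exists>U. open U \<and> e \<in> U \<and> (\<forall>N. real (card {n. n < N \<and> mantissa3 D n \<in> U}) \<le> \<delta> * real N + 1)"
    if "e \<in> ?E" "\<delta> > 0" for e \<delta>
    using that irr by (intro mantissa3_no_atom[OF D]) blast+
  show "continuous_on UNIV (\<lambda>y. damping p l (a * y))" for l
    unfolding damping_def coin_char_def by (intro continuous_intros)
  show "(\<lambda>l. damping p l (a * t)) \<longlonglongrightarrow> 0" if "t \<notin> ?E" for t
    using that by (intro damping_tendsto_0 p) blast
  show "mantissa3 D n \<in> {1..3}" for n using mantissa3_bounds[OF D, of n] by simp
qed (use damping_le_1 damping_decreasing p \<epsilon> in auto)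

section \<open>A strong law for orthogonal sequences\<close>

text \<open>
  Between \<open>k\<^sup>2\<close> and \<open>(k + 1)\<^sup>2\<close> there are at most \<open>2 k\<close> further bounded terms, which is negligible
  against \<open>k\<^sup>2\<close>.
\<close>
lemma average_tendsto_0_from_squares:
  fixes w :: "nat \<Rightarrow> complex"
  assumes bound: "\<And>n. cmod (w n) \<le> C"
    and squares: "(\<lambda>k. (\<Sum>n<k\<^sup>2. w n) / of_nat (k\<^sup>2)) \<longlonglongrightarrow> 0"
  shows "(\<lambda>N. (\<Sum>n<N. w n) / of_nat N) \<longlonglongrightarrow> 0"
proof (rule Lim_null_comparison)
  have C0: "C \<ge> 0" using bound[of 0] norm_ge_zero order_trans by blast
  let ?r = "\<lambda>k. cmod ((\<Sum>n<k\<^sup>2. w n) / of_nat (k\<^sup>2)) + 2 * C / real k"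
  show "\<forall>\<^sub>F N in sequentially. cmod ((\<Sum>n<N. w n) / of_nat N) \<le> ?r (floor_sqrt N)"
    using eventually_gt_at_top[of "0::nat"]
  proof eventually_elim
    case (elim N)
    define k where "k = floor_sqrt N"
    have k: "k > 0" "k\<^sup>2 \<le> N" "N \<le> k\<^sup>2 + 2 * k"
      using elim Suc_floor_sqrt_power2_gt[of N] floor_sqrt_power2_le[of N]
      by (simp_all add: k_def power2_eq_square)
    have "(\<Sum>n<N. w n) = (\<Sum>n<k\<^sup>2. w n) + (\<Sum>n\<in>{k\<^sup>2..<N}. w n)"
      using k(2) by (simp add: lessThan_atLeast0 sum.atLeastLessThan_concat)
    moreover have "cmod (\<Sum>n\<in>{k\<^sup>2..<N}. w n) \<le> 2 * real k * C"
    proof -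
      have "cmod (\<Sum>n\<in>{k\<^sup>2..<N}. w n) \<le> of_nat (card {k\<^sup>2..<N}) * C"
        by (rule sum_norm_bound) (rule bound)
      also have "card {k\<^sup>2..<N} \<le> 2 * k" using k(3) by simp
      then have "of_nat (card {k\<^sup>2..<N}) * C \<le> 2 * real k * C"
        using C0 by (intro mult_right_mono) simp_all
      finally show ?thesis .
    qed
    ultimately have "cmod (\<Sum>n<N. w n) \<le> cmod (\<Sum>n<k\<^sup>2. w n) + 2 * real k * C"
      using norm_triangle_ineq order_trans add_left_mono by metis
    then have "cmod ((\<Sum>n<N. w n) / of_nat N) \<le> (cmod (\<Sum>n<k\<^sup>2. w n) + 2 * real k * C) / real N"
      by (simp add: norm_divide divide_right_mono)
    also have "\<dots> \<le> (cmod (\<Sum>n<k\<^sup>2. w n) + 2 * real k * C) / (real k)\<^sup>2"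
    proof (rule divide_left_mono)
      show "(real k)\<^sup>2 \<le> real N" using k(2) by (metis of_nat_le_iff of_nat_power)
    qed (use k elim C0 in auto)
    also have "\<dots> = ?r k"
      using k(1) by (simp add: norm_divide norm_mult add_divide_distrib power2_eq_square)
    finally show ?case unfolding k_def .
  qed
  have "filterlim floor_sqrt at_top sequentially"
    unfolding filterlim_at_top
  proof
    fix Z :: nat
    show "\<forall>\<^sub>F N in sequentially. Z \<le> floor_sqrt N"
      using eventually_ge_at_top[of "Z\<^sup>2"] by eventually_elim (rule le_floor_sqrtI)
  qed
  moreover have "?r \<longlonglongrightarrow> 0"
    using tendsto_add[OF tendsto_norm_zero[OF squares] tendsto_divide_0[OF tendsto_const filterlim_real_at_infinity_sequentially, of "2 * C"]]
    by simp
  ultimately show "(\<lambda>N. ?r (floor_sqrt N)) \<longlonglongrightarrow> 0"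
    by (rule filterlim_compose[rotated])
qed

context prob_space
begin

lemma integrable_bounded_complex:
  fixes f :: "'a \<Rightarrow> complex"
  assumes "f \<in> borel_measurable M" "\<And>\<omega>. cmod (f \<omega>) \<le> C"
  shows "integrable M f"
  using assms by (intro integrable_const_bound[where B = C]) auto

text \<open>
  Only the pairs of indices at distance less than \<^term>\<open>R\<close> contribute to the expanded square, and there
  are at most \<open>2 R\<close> partners for each index.
\<close>
lemma second_moment_orthogonal:
  fixes W :: "nat \<Rightarrow> 'a \<Rightarrow> complex"
  assumes meas[measurable]: "\<And>n. W n \<in> borel_measurable M"
    and bound: "\<And>n \<omega>. cmod (W n \<omega>) \<le> C"
    and orth: "\<And>m n. m + R \<le> n \<Longrightarrow> (\<integral>\<omega>. W n \<omega> * cnj (W m \<omega>) \<partial>M) = 0"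
  shows "(\<integral>\<omega>. (cmod (\<Sum>n<N. W n \<omega>))\<^sup>2 \<partial>M) \<le> real N * (2 * real R * C\<^sup>2)"
proof -
  have C0: "C \<ge> 0" using bound norm_ge_zero order_trans by blast
  have prod_bound: "cmod (W n \<omega> * cnj (W m \<omega>)) \<le> C\<^sup>2" for m n \<omega>
    using mult_mono[OF bound bound C0 norm_ge_zero] by (simp add: norm_mult power2_eq_square)
  have int: "integrable M (\<lambda>\<omega>. W n \<omega> * cnj (W m \<omega>))" for m n
  proof (rule integrable_bounded_complex[OF _ prod_bound])
    have "(\<lambda>\<omega>. cnj (W m \<omega>)) \<in> borel_measurable M"
      by (intro measurable_compose[OF meas] borel_measurable_continuous_onI continuous_intros)
    then show "(\<lambda>\<omega>. W n \<omega> * cnj (W m \<omega>)) \<in> borel_measurable M" by measurable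
  qed
  define c where "c n m = (\<integral>\<omega>. W n \<omega> * cnj (W m \<omega>) \<partial>M)" for n m
  have c_bound: "cmod (c n m) \<le> C\<^sup>2 * of_bool (m < n + R \<and> n < m + R)" for n m
  proof -
    consider "m + R \<le> n" | "n + R \<le> m" | "m < n + R \<and> n < m + R" by linarith
    then show ?thesis
    proof cases
      case 1
      then show ?thesis using orth by (simp add: c_def)
    next
      case 2
      have "c n m = cnj (c m n)" unfolding c_def by (simp add: mult.commute flip: Bochner_Integration.integral_cnj)
      also have "c m n = 0" using orth[OF 2] by (simp add: c_def)
      finally show ?thesis by simp
    next
      case 3
      have "cmod (c n m) \<le> (\<integral>\<omega>. cmod (W n \<omega> * cnj (W m \<omega>)) \<partial>M)"
        unfolding c_def by (rule integral_norm_bound)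
      also have "\<dots> \<le> C\<^sup>2"
        using integral_le_const[of "\<lambda>\<omega>. cmod (W n \<omega> * cnj (W m \<omega>))" "C\<^sup>2"] int prod_bound by auto
      finally show ?thesis using 3 by simp
    qed
  qed
  have "complex_of_real (\<integral>\<omega>. (cmod (\<Sum>n<N. W n \<omega>))\<^sup>2 \<partial>M) =
      (\<integral>\<omega>. complex_of_real ((cmod (\<Sum>n<N. W n \<omega>))\<^sup>2) \<partial>M)"
    by (simp only: integral_complex_of_real)
  also have "\<dots> = (\<integral>\<omega>. (\<Sum>n<N. \<Sum>m<N. W n \<omega> * cnj (W m \<omega>)) \<partial>M)"
    by (simp only: complex_norm_square cnj_sum sum_product)
  also have "\<dots> = (\<Sum>n<N. \<Sum>m<N. c n m)"
    by (simp add: int c_def)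
  finally have eq: "complex_of_real (\<integral>\<omega>. (cmod (\<Sum>n<N. W n \<omega>))\<^sup>2 \<partial>M) = (\<Sum>n<N. \<Sum>m<N. c n m)" .
  have "(\<integral>\<omega>. (cmod (\<Sum>n<N. W n \<omega>))\<^sup>2 \<partial>M) \<le> cmod (complex_of_real (\<integral>\<omega>. (cmod (\<Sum>n<N. W n \<omega>))\<^sup>2 \<partial>M))"
    by (simp only: norm_of_real abs_ge_self)
  also have "\<dots> \<le> (\<Sum>n<N. \<Sum>m<N. C\<^sup>2 * of_bool (m < n + R \<and> n < m + R))"
    unfolding eq by (intro sum_norm_le c_bound)
  also have "\<dots> \<le> (\<Sum>n<N. 2 * real R * C\<^sup>2)"
  proof (rule sum_mono)
    fix n
    have "(\<Sum>m<N. of_bool (m < n + R \<and> n < m + R)) = real (card ({..<N} \<inter> {m. m < n + R \<and> n < m + R}))"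
      by (simp add: sum_of_bool_eq)
    also have "\<dots> \<le> real (card {n - R..<n + R})"
      by (intro of_nat_mono card_mono) auto
    also have "\<dots> \<le> 2 * real R" by simp
    finally have "C\<^sup>2 * (\<Sum>m<N. of_bool (m < n + R \<and> n < m + R)) \<le> C\<^sup>2 * (2 * real R)"
      by (intro mult_left_mono) auto
    then show "(\<Sum>m<N. C\<^sup>2 * of_bool (m < n + R \<and> n < m + R)) \<le> 2 * real R * C\<^sup>2"
      by (simp only: sum_distrib_left mult.commute)
  qed
  finally show ?thesis by simp
qed

text \<open>
  A strong law of large numbers. The second moments of the averages are of order \<open>1 / N\<close>, hence
  summable along the squares, and boundedness fills the gaps between squares.
\<close>
lemma AE_average_orthogonal:
  fixes W :: "nat \<Rightarrow> 'a \<Rightarrow> complex"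
  assumes meas[measurable]: "\<And>n. W n \<in> borel_measurable M"
    and bound: "\<And>n \<omega>. cmod (W n \<omega>) \<le> C"
    and orth: "\<And>m n. m + R \<le> n \<Longrightarrow> (\<integral>\<omega>. W n \<omega> * cnj (W m \<omega>) \<partial>M) = 0"
  shows "AE \<omega> in M. (\<lambda>N. (\<Sum>n<N. W n \<omega>) / of_nat N) \<longlonglongrightarrow> 0"
proof -
  define Q where "Q k \<omega> = (cmod ((\<Sum>n<k\<^sup>2. W n \<omega>) / of_nat (k\<^sup>2)))\<^sup>2" for k \<omega>
  define q where "q k = 2 * real R * C\<^sup>2 * (1 / real k ^ 2)" for k
  have Q_nonneg: "0 \<le> Q k \<omega>" for k \<omega> by (simp add: Q_def)
  have [measurable]: "Q k \<in> borel_measurable M" for k unfolding Q_def by measurable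
  have Sbound: "cmod (\<Sum>n<N. W n \<omega>) \<le> real N * C" for N \<omega>
    using sum_norm_bound[of "{..<N}" "\<lambda>n. W n \<omega>" C] bound by simp
  have intS: "integrable M (\<lambda>\<omega>. (cmod (\<Sum>n<N. W n \<omega>))\<^sup>2)" for N
  proof (rule integrable_const_bound[where B = "(real N * C)\<^sup>2"])
    show "AE \<omega> in M. norm ((cmod (\<Sum>n<N. W n \<omega>))\<^sup>2) \<le> (real N * C)\<^sup>2"
      using Sbound by (auto intro!: power_mono)
  qed measurable
  have Q_eq: "Q k \<omega> = (cmod (\<Sum>n<k\<^sup>2. W n \<omega>))\<^sup>2 / (real (k\<^sup>2))\<^sup>2" for k \<omega>
    unfolding Q_def by (simp only: norm_divide norm_of_nat power_divide)
  have intQ: "integrable M (Q k)" for k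
    unfolding Q_eq[abs_def] using intS by (rule integrable_divide)
  have EQ: "(\<integral>\<omega>. Q k \<omega> \<partial>M) \<le> q k" for k
  proof -
    have "(\<integral>\<omega>. Q k \<omega> \<partial>M) = (\<integral>\<omega>. (cmod (\<Sum>n<k\<^sup>2. W n \<omega>))\<^sup>2 \<partial>M) / (real (k\<^sup>2))\<^sup>2"
      unfolding Q_eq by (rule integral_divide_zero)
    also have "\<dots> \<le> real (k\<^sup>2) * (2 * real R * C\<^sup>2) / (real (k\<^sup>2))\<^sup>2"
      by (intro divide_right_mono second_moment_orthogonal[OF meas bound orth]) auto
    also have "\<dots> = q k" by (cases "k = 0") (auto simp: q_def power2_eq_square)
    finally show ?thesis .
  qed
  have "(\<integral>\<^sup>+\<omega>. (\<Sum>k. ennreal (Q k \<omega>)) \<partial>M) = (\<Sum>k. \<integral>\<^sup>+\<omega>. ennreal (Q k \<omega>) \<partial>M)"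
    by (rule nn_integral_suminf) measurable
  also have "\<dots> = (\<Sum>k. ennreal (\<integral>\<omega>. Q k \<omega> \<partial>M))"
    using intQ by (intro suminf_cong nn_integral_eq_integral AE_I2) (simp_all add: Q_nonneg)
  also have "\<dots> \<le> (\<Sum>k. ennreal (q k))"
    by (intro suminf_le ennreal_leI EQ) auto
  also have "\<dots> < top"
  proof -
    have "summable q" unfolding q_def
      by (intro summable_mult inverse_power_summable[where s = 2, unfolded inverse_eq_divide]) auto
    moreover have "0 \<le> q k" for k by (simp add: q_def)
    ultimately have "(\<Sum>k. ennreal (q k)) \<noteq> top" by (rule ennreal_suminf_neq_top)
    then show ?thesis by (simp only: less_top)
  qed
  finally have "(\<integral>\<^sup>+\<omega>. (\<Sum>k. ennreal (Q k \<omega>)) \<partial>M) \<noteq> \<infinity>" by simp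
  then have "AE \<omega> in M. (\<Sum>k. ennreal (Q k \<omega>)) \<noteq> \<infinity>"
    by (intro nn_integral_PInf_AE) measurable
  then show ?thesis
  proof eventually_elim
    case (elim \<omega>)
    then have "summable (\<lambda>k. Q k \<omega>)"
      by (intro summable_suminf_not_top) (auto simp: Q_def)
    then have "(\<lambda>k. sqrt (Q k \<omega>)) \<longlonglongrightarrow> sqrt 0" by (intro tendsto_real_sqrt summable_LIMSEQ_zero)
    then have "(\<lambda>k. (\<Sum>n<k\<^sup>2. W n \<omega>) / of_nat (k\<^sup>2)) \<longlonglongrightarrow> 0"
      unfolding Q_def by (simp only: real_sqrt_abs abs_norm_cancel real_sqrt_zero tendsto_norm_zero_iff)
    then show ?case using bound by (rule average_tendsto_0_from_squares[rotated])
  qed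
qed

end

section \<open>Past and future of independent coordinates\<close>

context sequence_space
begin

text \<open>
  Independence of past and future in the form of an iterated integral: the first \<^term>\<open>a\<close> coordinates
  may be drawn from one sequence and the others from a second one.
\<close>
lemma integral_split_at:
  fixes h :: "(nat \<Rightarrow> 'a) \<Rightarrow> complex"
  assumes [measurable]: "h \<in> borel_measurable S" and bound: "\<And>\<omega>. cmod (h \<omega>) \<le> C"
  shows "(\<integral>\<omega>. h \<omega> \<partial>S) = (\<integral>\<omega>. (\<integral>\<omega>'. h (comb_seq a \<omega> \<omega>') \<partial>S) \<partial>S)"
proof -
  interpret SS: pair_prob_space S S ..
  have "(\<integral>\<omega>. h \<omega> \<partial>S) = (\<integral>\<omega>. h \<omega> \<partial>distr (S \<Otimes>\<^sub>M S) S (\<lambda>(\<omega>, \<omega>'). comb_seq a \<omega> \<omega>'))"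
    by (simp only: PiM_comb_seq)
  also have "\<dots> = (\<integral>x. h (case x of (\<omega>, \<omega>') \<Rightarrow> comb_seq a \<omega> \<omega>') \<partial>(S \<Otimes>\<^sub>M S))"
    by (intro integral_distr measurable_comb_seq) measurable
  also have "\<dots> = (\<integral>\<omega>. (\<integral>\<omega>'. h (comb_seq a \<omega> \<omega>') \<partial>S) \<partial>S)"
  proof (subst SS.integral_fst'[symmetric])
    show "integrable (S \<Otimes>\<^sub>M S) (\<lambda>x. h (case x of (\<omega>, \<omega>') \<Rightarrow> comb_seq a \<omega> \<omega>'))"
      by (rule SS.P.integrable_const_bound[where B = C]) (auto simp: bound)
  qed simp
  finally show ?thesis .
qed

lemma integral_past_times_future:
  fixes f g :: "(nat \<Rightarrow> 'a) \<Rightarrow> complex"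
  assumes [measurable]: "f \<in> borel_measurable S" "g \<in> borel_measurable S"
    and bound: "\<And>\<omega>. cmod (f \<omega>) \<le> B" "\<And>\<omega>. cmod (g \<omega>) \<le> C"
    and past: "\<And>\<omega> \<omega>'. (\<And>k. k < a \<Longrightarrow> \<omega> k = \<omega>' k) \<Longrightarrow> f \<omega> = f \<omega>'"
    and future: "\<And>\<omega> \<omega>'. (\<And>k. a \<le> k \<Longrightarrow> \<omega> k = \<omega>' k) \<Longrightarrow> g \<omega> = g \<omega>'"
  shows "(\<integral>\<omega>. f \<omega> * g \<omega> \<partial>S) = (\<integral>\<omega>. f \<omega> \<partial>S) * (\<integral>\<omega>. g \<omega> \<partial>S)"
proof -
  \<comment> \<open>A future function does not see the first coordinates, so its inner integral is a constant.\<close>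
  define c where "c = (\<integral>\<omega>'. g (comb_seq a undefined \<omega>') \<partial>S)"
  have f: "f (comb_seq a \<omega> \<omega>') = f \<omega>" for \<omega> \<omega>' by (rule past) (simp add: comb_seq_less)
  have g: "g (comb_seq a \<omega> \<omega>') = g (comb_seq a undefined \<omega>')" for \<omega> \<omega>'
    by (rule future) (simp add: comb_seq_def)
  have B0: "B \<ge> 0" using bound(1) norm_ge_zero order_trans by blast
  have "cmod (f \<omega> * g \<omega>) \<le> B * C" for \<omega>
    unfolding norm_mult by (intro mult_mono bound B0) auto
  then have "(\<integral>\<omega>. f \<omega> * g \<omega> \<partial>S) = (\<integral>\<omega>. (\<integral>\<omega>'. f (comb_seq a \<omega> \<omega>') * g (comb_seq a \<omega> \<omega>') \<partial>S) \<partial>S)"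
    by (intro integral_split_at[of _ "B * C"]) measurable
  also have "\<dots> = (\<integral>\<omega>. (\<integral>\<omega>'. f \<omega> * g (comb_seq a undefined \<omega>') \<partial>S) \<partial>S)"
    by (intro Bochner_Integration.integral_cong refl arg_cong2[where f = "(*)"] f g)
  also have "\<dots> = (\<integral>\<omega>. f \<omega> * c \<partial>S)" by (simp add: c_def)
  also have "\<dots> = (\<integral>\<omega>. f \<omega> \<partial>S) * c" by simp
  also have "c = (\<integral>\<omega>. (\<integral>\<omega>'. g (comb_seq a \<omega> \<omega>') \<partial>S) \<partial>S)"
  proof -
    have "(\<integral>\<omega>. (\<integral>\<omega>'. g (comb_seq a \<omega> \<omega>') \<partial>S) \<partial>S) = (\<integral>\<omega>. c \<partial>S)"
      unfolding c_def by (intro Bochner_Integration.integral_cong refl g)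
    then show ?thesis by (simp add: P.prob_space)
  qed
  also have "\<dots> = (\<integral>\<omega>. g \<omega> \<partial>S)"
    using bound(2) by (intro integral_split_at[symmetric, of _ C]) measurable
  finally show ?thesis .
qed

lemma integral_prod_coordinates:
  fixes e :: "nat \<Rightarrow> 'a \<Rightarrow> complex"
  assumes [measurable]: "\<And>k. e k \<in> borel_measurable M" and bound: "\<And>k x. cmod (e k x) \<le> 1"
    and ab: "a \<le> b"
  shows "(\<integral>\<omega>. (\<Prod>k=a..<b. e k (\<omega> k)) \<partial>S) = (\<Prod>k=a..<b. \<integral>x. e k x \<partial>M)"
  using ab
proof (induction b rule: dec_induct)
  case base
  then show ?case by (simp add: P.prob_space)
next
  case (step b)
  have "(\<integral>\<omega>. (\<Prod>k=a..<Suc b. e k (\<omega> k)) \<partial>S) = (\<integral>\<omega>. (\<Prod>k=a..<b. e k (\<omega> k)) * e b (\<omega> b) \<partial>S)"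
    using step by (simp add: prod.atLeastLessThan_Suc)
  also have "\<dots> = (\<integral>\<omega>. (\<Prod>k=a..<b. e k (\<omega> k)) \<partial>S) * (\<integral>\<omega>. e b (\<omega> b) \<partial>S)"
  proof (rule integral_past_times_future[where a = b and B = 1 and C = 1])
    show "cmod (\<Prod>k=a..<b. e k (\<omega> k)) \<le> 1" for \<omega>
      unfolding prod_norm[symmetric] using bound by (intro prod_le_1) auto
  qed (use bound in \<open>auto intro!: prod.cong\<close>)
  also have "(\<integral>\<omega>. e b (\<omega> b) \<partial>S) = (\<integral>x. e b x \<partial>distr S M (\<lambda>\<omega>. \<omega> b))"
    by (subst integral_distr) auto
  also have "\<dots> = (\<integral>x. e b x \<partial>M)" using PiM_component[of b] by simp
  finally show ?case using step by (simp add: prod.atLeastLessThan_Suc)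
qed

end

section \<open>Coding of the Cantor set\<close>

text \<open>
  A sequence of digits 0 and 1, read as the point of the Cantor set with the doubled ternary digits.
\<close>
definition cantor_value :: "(nat \<Rightarrow> bool) \<Rightarrow> real" where
  "cantor_value \<omega> = (\<Sum>k. 2 * of_bool (\<omega> k) / 3 ^ Suc k)"

lemma two_thirds_geometric_sums: "(\<lambda>k. 2 / 3 ^ Suc k :: real) sums 1"
  using sums_mult[OF geometric_sums[of "1/3 :: real"], of "2/3"] by (simp add: power_one_over divide_simps)

lemma summable_cantor_value: "summable (\<lambda>k. 2 * of_bool (\<omega> k) / 3 ^ Suc k :: real)"
  by (rule summable_comparison_test'[OF sums_summable[OF two_thirds_geometric_sums], of 0]) auto

lemma cantor_value_truncation:
  "\<bar>cantor_value \<omega> - (\<Sum>k<b. 2 * of_bool (\<omega> k) / 3 ^ Suc k)\<bar> \<le> 1 / 3 ^ b"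
proof -
  let ?f = "\<lambda>k. 2 * of_bool (\<omega> k) / 3 ^ Suc k :: real"
  have "cantor_value \<omega> - (\<Sum>k<b. ?f k) = (\<Sum>k. ?f (k + b))"
    unfolding cantor_value_def by (rule suminf_minus_initial_segment[OF summable_cantor_value, symmetric])
  moreover have "(\<lambda>k. 2 / 3 ^ Suc (k + b) :: real) sums (1 / 3 ^ b)"
    using sums_mult[OF two_thirds_geometric_sums, of "1 / 3 ^ b"] by (simp add: power_add mult_ac)
  moreover have "summable (\<lambda>k. ?f (k + b))"
    using summable_cantor_value by (rule summable_ignore_initial_segment)
  ultimately show ?thesis
    using suminf_le[of "\<lambda>k. ?f (k + b)" "\<lambda>k. 2 / 3 ^ Suc (k + b)"] suminf_nonneg[of "\<lambda>k. ?f (k + b)"]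
    by (auto simp: sums_iff divide_right_mono)
qed

lemma coding_map_scaled_cantor_ifs:
  "coding_map (scaled_cantor_ifs \<alpha> \<beta>) \<omega> = \<alpha> * cantor_value \<omega> + \<beta>"
proof -
  have step: "scaled_cantor_ifs \<alpha> \<beta> i y = y / 3 + (\<alpha> * (2 * of_bool i / 3) + \<beta> * (2 / 3))" for i y
    by (cases i) (auto simp: scaled_cantor_ifs_def)
  have "foldr (scaled_cantor_ifs \<alpha> \<beta>) (map \<omega> [0..<n]) y = y / 3 ^ n +
      (\<alpha> * (\<Sum>k<n. 2 * of_bool (\<omega> k) / 3 ^ Suc k) + \<beta> * (\<Sum>k<n. 2 / 3 ^ Suc k))" for n y
  proof (induction n arbitrary: y)
    case (Suc n)
    then show ?case by (simp add: step field_simps)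
  qed simp
  then have "(\<lambda>n. foldr (scaled_cantor_ifs \<alpha> \<beta>) (map \<omega> [0..<n]) 0) =
      (\<lambda>n. \<alpha> * (\<Sum>k<n. 2 * of_bool (\<omega> k) / 3 ^ Suc k) + \<beta> * (\<Sum>k<n. 2 / 3 ^ Suc k))" by simp
  moreover have "\<dots> \<longlonglongrightarrow> \<alpha> * cantor_value \<omega> + \<beta> * 1"
    using summable_LIMSEQ[OF summable_cantor_value] two_thirds_geometric_sums unfolding sums_def cantor_value_def
    by (intro tendsto_add tendsto_mult_left)
  ultimately show ?thesis unfolding coding_map_def by (simp add: limI)
qed

section \<open>Fluctuations of exponentials\<close>

text \<open>
  The contribution of one digit to \<open>exp (\<i> \<theta> Y)\<close>, where \<open>Y\<close> is the point of the Cantor set.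
\<close>
definition digit_phase :: "real \<Rightarrow> nat \<Rightarrow> bool \<Rightarrow> complex" where
  "digit_phase \<theta> k i = cis (\<theta> * (2 * of_bool i / 3 ^ Suc k))"

text \<open>
  The exponential \<open>u exp (\<i> \<theta> Y)\<close>, truncated to the digits before \<^term>\<open>b\<close>, minus its conditional
  expectation given the digits before \<^term>\<open>a\<close>.
\<close>
definition fluctuation :: "real \<Rightarrow> complex \<Rightarrow> real \<Rightarrow> nat \<Rightarrow> nat \<Rightarrow> (nat \<Rightarrow> bool) \<Rightarrow> complex" where
  "fluctuation p u \<theta> a b \<omega> = u * (\<Prod>k<a. digit_phase \<theta> k (\<omega> k)) *
     ((\<Prod>k=a..<b. digit_phase \<theta> k (\<omega> k)) - (\<Prod>k=a..<b. coin_char p (2 * \<theta> / 3 ^ Suc k)))"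

lemma norm_digit_phase: "cmod (digit_phase \<theta> k i) = 1"
  by (simp add: digit_phase_def)

lemma norm_prod_digit_phase: "cmod (\<Prod>k\<in>I. digit_phase \<theta> k (\<omega> k)) = 1"
  by (simp add: norm_digit_phase flip: prod_norm)

lemma norm_prod_coin_char_le_1:
  assumes "0 \<le> p" "p \<le> 1"
  shows "cmod (\<Prod>k\<in>I. coin_char p (x k)) \<le> 1"
  unfolding prod_norm[symmetric] using norm_coin_char_le_1[OF assms] by (intro prod_le_1) auto

lemma norm_fluctuation_le_2:
  assumes "0 \<le> p" "p \<le> 1" "cmod u = 1"
  shows "cmod (fluctuation p u \<theta> a b \<omega>) \<le> 2"
proof -
  have "cmod (fluctuation p u \<theta> a b \<omega>) =
      cmod ((\<Prod>k=a..<b. digit_phase \<theta> k (\<omega> k)) - (\<Prod>k=a..<b. coin_char p (2 * \<theta> / 3 ^ Suc k)))"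
    using assms(3) by (simp add: fluctuation_def norm_mult norm_prod_digit_phase)
  also have "\<dots> \<le> 1 + 1"
    by (intro order_trans[OF norm_triangle_ineq4] add_mono norm_prod_coin_char_le_1[OF assms(1,2)])
      (simp add: norm_prod_digit_phase)
  finally show ?thesis by simp
qed

lemma fluctuation_cong:
  assumes "\<And>k. k < b \<Longrightarrow> \<omega> k = \<omega>' k" "a \<le> b"
  shows "fluctuation p u \<theta> a b \<omega> = fluctuation p u \<theta> a b \<omega>'"
  using assms by (auto simp: fluctuation_def intro!: arg_cong2[where f = "(*)"] arg_cong2[where f = "(-)"] prod.cong)

lemma norm_cis_diff_le: "cmod (cis x - cis y) \<le> \<bar>x - y\<bar>"
proof (rule power2_le_imp_le)
  have "(cmod (cis x - cis y))\<^sup>2 = (cos x - cos y)\<^sup>2 + (sin x - sin y)\<^sup>2"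
    by (simp add: cmod_power2)
  also have "\<dots> = ((cos x)\<^sup>2 + (sin x)\<^sup>2) + ((cos y)\<^sup>2 + (sin y)\<^sup>2) - 2 * cos (x - y)"
    by (simp add: power2_diff cos_diff algebra_simps del: sin_cos_squared_add2 sin_cos_squared_add)
  also have "\<dots> = 2 - 2 * cos (x - y)" by simp
  also have "\<dots> = (2 * sin ((x - y) / 2))\<^sup>2"
  proof -
    have half: "2 * ((x - y) / 2) = x - y" by simp
    show ?thesis using cos_double_sin[of "(x - y) / 2"] unfolding half by (simp add: power_mult_distrib)
  qed
  also have "\<dots> \<le> \<bar>x - y\<bar>\<^sup>2"
    using abs_sin_x_le_abs_x[of "(x - y) / 2"] by (simp only: abs_le_square_iff[symmetric]) (simp add: abs_mult)
  finally show "(cmod (cis x - cis y))\<^sup>2 \<le> \<bar>x - y\<bar>\<^sup>2" .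
qed simp

text \<open>
  The first term is the error of truncating at \<^term>\<open>b\<close>; the second one is the modulus of the
  conditional expectation, which is the same for all points.
\<close>
lemma cis_cantor_value_approx:
  assumes "cmod u = 1" "a \<le> b"
  shows "cmod (u * cis (\<theta> * cantor_value \<omega>) - fluctuation p u \<theta> a b \<omega>) \<le>
    \<bar>\<theta>\<bar> / 3 ^ b + cmod (\<Prod>k=a..<b. coin_char p (2 * \<theta> / 3 ^ Suc k))"
proof -
  let ?t = "\<Sum>k<b. 2 * of_bool (\<omega> k) / 3 ^ Suc k"
  let ?past = "\<Prod>k<a. digit_phase \<theta> k (\<omega> k)" and ?m = "\<Prod>k=a..<b. coin_char p (2 * \<theta> / 3 ^ Suc k)"
  have cis_sum: "cis (\<Sum>k<n. f k) = (\<Prod>k<n. cis (f k))" for f :: "nat \<Rightarrow> real" and n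
    by (induction n) (auto simp: cis_mult[symmetric])
  have "cis (\<theta> * ?t) = (\<Prod>k<b. digit_phase \<theta> k (\<omega> k))"
    unfolding sum_distrib_left cis_sum digit_phase_def ..
  also have "\<dots> = ?past * (\<Prod>k=a..<b. digit_phase \<theta> k (\<omega> k))"
    unfolding lessThan_atLeast0 using assms(2) by (simp add: prod.atLeastLessThan_concat)
  finally have trunc: "u * cis (\<theta> * ?t) - fluctuation p u \<theta> a b \<omega> = u * ?past * ?m"
    by (simp add: fluctuation_def algebra_simps)
  have "u * cis (\<theta> * cantor_value \<omega>) - fluctuation p u \<theta> a b \<omega> =
      u * (cis (\<theta> * cantor_value \<omega>) - cis (\<theta> * ?t)) + u * ?past * ?m"
    unfolding trunc[symmetric] by (simp add: algebra_simps)
  also have "cmod \<dots> \<le> cmod (cis (\<theta> * cantor_value \<omega>) - cis (\<theta> * ?t)) + cmod ?m"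
    using norm_triangle_ineq[of "u * (cis (\<theta> * cantor_value \<omega>) - cis (\<theta> * ?t))" "u * ?past * ?m"] assms(1)
    by (simp add: norm_mult norm_prod_digit_phase)
  also have "cmod (cis (\<theta> * cantor_value \<omega>) - cis (\<theta> * ?t)) \<le> \<bar>\<theta> * cantor_value \<omega> - \<theta> * ?t\<bar>"
    by (rule norm_cis_diff_le)
  also have "\<dots> = \<bar>\<theta>\<bar> * \<bar>cantor_value \<omega> - ?t\<bar>" by (simp only: right_diff_distrib[symmetric] abs_mult)
  also have "\<dots> \<le> \<bar>\<theta>\<bar> * (1 / 3 ^ b)" by (intro mult_left_mono cantor_value_truncation) simp
  finally show ?thesis by simp
qed

text \<open>
  The factors of the digits from the scale of \<open>D\<^sup>n\<close> on are discarded. The digit that is \<open>j + 1\<close> places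
  before the scale sees the frequency multiplied by \<open>3\<^sup>j\<close>, which gives exactly the factors of the
  damping.
\<close>
lemma norm_window_coin_char_le_damping:
  assumes D: "D \<ge> 2" and p: "0 \<le> p" "p \<le> 1" and l: "l \<le> ternary_scale D n"
  shows "cmod (\<Prod>k=ternary_scale D n - l..<ternary_scale D n + l.
      coin_char p (2 * (2 * pi * t * real D ^ n) / 3 ^ Suc k)) \<le> damping p l (2 * t * mantissa3 D n)"
proof -
  define s where "s = ternary_scale D n"
  define f where "f k = coin_char p (2 * (2 * pi * t * real D ^ n) / 3 ^ Suc k)" for k
  have "(\<Prod>k=s - l..<s + l. f k) = (\<Prod>k=s - l..<s. f k) * (\<Prod>k=s..<s + l. f k)"
    by (simp add: prod.atLeastLessThan_concat)
  then have "cmod (\<Prod>k=s - l..<s + l. f k) = cmod (\<Prod>k=s - l..<s. f k) * cmod (\<Prod>k=s..<s + l. f k)"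
    by (simp add: norm_mult)
  also have "\<dots> \<le> cmod (\<Prod>k=s - l..<s. f k)"
    unfolding f_def by (intro mult_left_le norm_prod_coin_char_le_1[OF p]) simp
  also have "\<dots> = (\<Prod>k=s - l..<s. cmod (f k))" by (rule prod_norm[symmetric])
  also have "\<dots> = (\<Prod>j<l. cmod (f (s - Suc j)))"
    using l by (intro prod.reindex_bij_witness[where i = "\<lambda>j. s - Suc j" and j = "\<lambda>k. s - Suc k"]) (auto simp: s_def)
  also have "\<dots> = damping p l (2 * t * mantissa3 D n)"
    unfolding damping_def
  proof (intro prod.cong refl arg_cong[where f = cmod])
    fix j assume "j \<in> {..<l}"
    then have j: "Suc (s - Suc j) + j = s" using l by (simp add: s_def)
    have "(3::real) ^ Suc (s - Suc j) * 3 ^ j = 3 ^ s" unfolding power_add[symmetric] j ..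
    then have "2 * (2 * pi * t * real D ^ n) / 3 ^ Suc (s - Suc j) = 2 * pi * (3 ^ j * (2 * t * mantissa3 D n))"
      unfolding mantissa3_def s_def[symmetric] by (simp add: field_simps)
    then show "f (s - Suc j) = coin_char p (2 * pi * (3 ^ j * (2 * t * mantissa3 D n)))"
      unfolding f_def by simp
  qed
  finally show ?thesis unfolding f_def s_def .
qed

lemma coordinate_measurable [measurable]:
  "(\<lambda>\<omega>. \<omega> k) \<in> PiM UNIV (\<lambda>_::nat. measure_pmf P) \<rightarrow>\<^sub>M count_space UNIV"
  using measurable_component_singleton[of k UNIV "\<lambda>_. measure_pmf P"]
  by (simp cong: measurable_cong_sets)

lemma digit_phase_measurable [measurable]: "digit_phase \<theta> k \<in> borel_measurable (count_space UNIV)"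
  by simp

lemma fluctuation_measurable [measurable]:
  "fluctuation p u \<theta> a b \<in> borel_measurable (PiM UNIV (\<lambda>_::nat. measure_pmf P))"
  unfolding fluctuation_def[abs_def] by measurable

lemma cantor_value_measurable [measurable]:
  "cantor_value \<in> borel_measurable (PiM UNIV (\<lambda>_::nat. measure_pmf P))"
  unfolding cantor_value_def[abs_def] by measurable

lemma sequence_space_pmf: "sequence_space (measure_pmf P)"
  unfolding sequence_space_def product_prob_space_def product_prob_space_axioms_def product_sigma_finite_def
  by (auto simp: prob_space_measure_pmf intro: prob_space_imp_sigma_finite)

lemma pmf_True_plus_False: "pmf P True + pmf P False = 1"
proof -
  have "(\<Sum>i\<in>{True, False}. pmf P i) = 1" by (rule sum_pmf_eq_1) auto
  then show ?thesis by simp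
qed

lemma integral_digit_phase:
  "(\<integral>i. digit_phase \<theta> k i \<partial>measure_pmf P) = coin_char (pmf P True) (2 * \<theta> / 3 ^ Suc k)"
proof -
  have F: "pmf P False = 1 - pmf P True" using pmf_True_plus_False[of P] by linarith
  have "(\<integral>i. digit_phase \<theta> k i \<partial>measure_pmf P) = (\<Sum>i\<in>UNIV. pmf P i *\<^sub>R digit_phase \<theta> k i)"
    by (rule integral_measure_pmf) auto
  also have "\<dots> = of_real (1 - pmf P True) * digit_phase \<theta> k False + of_real (pmf P True) * digit_phase \<theta> k True"
    unfolding F[symmetric] by (simp add: UNIV_bool scaleR_conv_of_real)
  also have "\<dots> = coin_char (pmf P True) (2 * \<theta> / 3 ^ Suc k)"
    by (simp add: digit_phase_def coin_char_def mult.commute)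
  finally show ?thesis .
qed

text \<open>
  The fluctuation is a function of the digits before \<^term>\<open>a\<close> times a centred function of the other
  digits.
\<close>
lemma fluctuation_orthogonal_to_past:
  fixes f :: "(nat \<Rightarrow> bool) \<Rightarrow> complex"
  assumes [measurable]: "f \<in> borel_measurable (PiM UNIV (\<lambda>_::nat. measure_pmf P))" and bound: "\<And>\<omega>. cmod (f \<omega>) \<le> C"
    and past: "\<And>\<omega> \<omega>'. (\<And>k. k < a \<Longrightarrow> \<omega> k = \<omega>' k) \<Longrightarrow> f \<omega> = f \<omega>'"
    and u: "cmod u = 1" and ab: "a \<le> b"
  shows "(\<integral>\<omega>. fluctuation (pmf P True) u \<theta> a b \<omega> * f \<omega>
    \<partial>PiM UNIV (\<lambda>_::nat. measure_pmf P)) = 0"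
proof -
  interpret sequence_space "measure_pmf P" by (rule sequence_space_pmf)
  let ?m = "\<Prod>k=a..<b. coin_char (pmf P True) (2 * \<theta> / 3 ^ Suc k)"
  define g where "g \<omega> = f \<omega> * (u * (\<Prod>k<a. digit_phase \<theta> k (\<omega> k)))" for \<omega>
  define v where "v \<omega> = (\<Prod>k=a..<b. digit_phase \<theta> k (\<omega> k)) - ?m" for \<omega>
  have p: "0 \<le> pmf P True" "pmf P True \<le> 1" by (auto simp: pmf_le_1)
  have [measurable]: "g \<in> borel_measurable S" "v \<in> borel_measurable S"
    unfolding g_def v_def by measurable
  have intp: "integrable S (\<lambda>\<omega>. \<Prod>k=a..<b. digit_phase \<theta> k (\<omega> k))"
    by (rule P.integrable_bounded_complex[where C = 1]) (measurable, simp add: norm_prod_digit_phase)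
  have "(\<integral>\<omega>. v \<omega> \<partial>S) = (\<integral>\<omega>. (\<Prod>k=a..<b. digit_phase \<theta> k (\<omega> k)) \<partial>S) - ?m"
    unfolding v_def using intp by (simp add: P.prob_space)
  also have "(\<integral>\<omega>. (\<Prod>k=a..<b. digit_phase \<theta> k (\<omega> k)) \<partial>S) = ?m"
    by (subst integral_prod_coordinates) (simp_all add: norm_digit_phase ab integral_digit_phase)
  finally have v0: "(\<integral>\<omega>. v \<omega> \<partial>S) = 0" by simp
  have "(\<integral>\<omega>. g \<omega> * v \<omega> \<partial>S) = (\<integral>\<omega>. g \<omega> \<partial>S) * (\<integral>\<omega>. v \<omega> \<partial>S)"
  proof (rule integral_past_times_future[where a = a and B = C and C = 2])
    show "cmod (g \<omega>) \<le> C" for \<omega>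
      using bound[of \<omega>] u by (simp add: g_def norm_mult norm_prod_digit_phase)
    show "cmod (v \<omega>) \<le> 2" for \<omega>
      using norm_triangle_ineq4[of "\<Prod>k=a..<b. digit_phase \<theta> k (\<omega> k)" ?m]
        norm_prod_coin_char_le_1[OF p, of "\<lambda>k. 2 * \<theta> / 3 ^ Suc k" "{a..<b}"]
      by (simp add: v_def norm_prod_digit_phase)
    show "g \<omega> = g \<omega>'" if "\<And>k. k < a \<Longrightarrow> \<omega> k = \<omega>' k" for \<omega> \<omega>'
      using that past[of \<omega> \<omega>'] by (simp add: g_def)
    show "v \<omega> = v \<omega>'" if "\<And>k. a \<le> k \<Longrightarrow> \<omega> k = \<omega>' k" for \<omega> \<omega>'
      using that by (simp add: v_def)
  qed measurable
  moreover have "fluctuation (pmf P True) u \<theta> a b \<omega> * f \<omega> = g \<omega> * v \<omega>" for \<omega>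
    by (simp add: fluctuation_def g_def v_def mult_ac)
  ultimately show ?thesis using v0 by simp
qed

text \<open>
  If \<open>n\<close> is at least \<open>m + 4 l\<close>, then the window of \<open>n\<close> starts after the window of \<open>m\<close> has ended, so
  the two fluctuations are orthogonal.
\<close>
lemma AE_average_fluctuation:
  assumes D: "D \<ge> 2" and u: "\<And>n. cmod (u n) = 1"
  shows "AE \<omega> in PiM UNIV (\<lambda>_::nat. measure_pmf P).
    (\<lambda>N. (\<Sum>n<N. fluctuation (pmf P True) (u n) (\<theta> n) (ternary_scale D n - l) (ternary_scale D n + l) \<omega>) / of_nat N)
      \<longlonglongrightarrow> 0"
proof -
  interpret sequence_space "measure_pmf P" by (rule sequence_space_pmf)
  let ?W = "\<lambda>n. fluctuation (pmf P True) (u n) (\<theta> n) (ternary_scale D n - l) (ternary_scale D n + l)"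
  have p: "0 \<le> pmf P True" "pmf P True \<le> 1" by (auto simp: pmf_le_1)
  show ?thesis
  proof (rule P.AE_average_orthogonal[where C = 2 and R = "4 * l"])
    show "?W n \<in> borel_measurable S" for n by measurable
    show bound: "cmod (?W n \<omega>) \<le> 2" for n \<omega> using p u by (rule norm_fluctuation_le_2)
    fix m n assume mn: "m + 4 * l \<le> n"
    have "ternary_scale D m + 2 * l \<le> ternary_scale D (m + 2 * (2 * l))"
      by (rule ternary_scale_growth[OF D])
    also have "\<dots> \<le> ternary_scale D n" using mn by (intro ternary_scale_mono[OF D]) simp
    finally have sep: "ternary_scale D m + l \<le> ternary_scale D n - l" by linarith
    have "(\<lambda>\<omega>. cnj (?W m \<omega>)) \<in> borel_measurable S"
      by (intro measurable_compose[OF fluctuation_measurable] borel_measurable_continuous_onI continuous_intros)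
    then show "(\<integral>\<omega>. ?W n \<omega> * cnj (?W m \<omega>) \<partial>S) = 0"
    proof (rule fluctuation_orthogonal_to_past[where C = 2])
      show "cmod (cnj (?W m \<omega>)) \<le> 2" for \<omega> using bound by simp
      show "cnj (?W m \<omega>) = cnj (?W m \<omega>')" if "\<And>k. k < ternary_scale D n - l \<Longrightarrow> \<omega> k = \<omega>' k" for \<omega> \<omega>'
        using that sep by (intro arg_cong[where f = cnj] fluctuation_cong) auto
    qed (use u in auto)
  qed
qed

text \<open>
  For fixed \<open>l\<close>, the Weyl sum differs from an average of fluctuations, which vanishes in the limit, by
  the truncation error \<open>\<eta> l\<close> and an average of dampings. Both are small for large \<open>l\<close>. The first
  \<open>2 l\<close> terms, where the window may begin before the first digit, are bounded trivially.
\<close>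
lemma AE_weyl_average:
  fixes P :: "bool pmf" and h :: int
  assumes P: "\<And>i. pmf P i > 0" and \<alpha>: "\<alpha> \<notin> \<rat>" and D: "D \<ge> 2" and h: "h \<noteq> (0::int)"
  shows "AE \<omega> in PiM UNIV (\<lambda>_::nat. measure_pmf P).
    (\<lambda>N. (\<Sum>n<N. cis (2 * pi * h * (real D ^ n * (\<alpha> * cantor_value \<omega> + \<beta>)))) / of_nat N) \<longlonglongrightarrow> 0"
proof -
  define M where "M = PiM UNIV (\<lambda>_::nat. measure_pmf P)"
  define p where "p = pmf P True"
  have p: "0 < p" "p < 1"
    using P[of True] P[of False] pmf_True_plus_False[of P] unfolding p_def by linarith+
  define s where "s = ternary_scale D"
  define \<theta> where "\<theta> n = 2 * pi * (h * \<alpha>) * real D ^ n" for n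
  define u where "u n = cis (2 * pi * h * real D ^ n * \<beta>)" for n
  define Z where "Z \<omega> n = u n * cis (\<theta> n * cantor_value \<omega>)" for \<omega> n
  define W where "W l \<omega> n = fluctuation p (u n) (\<theta> n) (s n - l) (s n + l) \<omega>" for l \<omega> n
  \<comment> \<open>The factor 6 is \<open>2\<close> from \<open>2 \<pi>\<close> times the bound 3 for mantissas.\<close>
  define \<eta> where "\<eta> l = 6 * pi * \<bar>h * \<alpha>\<bar> * (1 / 3) ^ l" for l :: nat
  have u: "cmod (u n) = 1" for n by (simp add: u_def)
  have Z: "cis (2 * pi * h * (real D ^ n * (\<alpha> * cantor_value \<omega> + \<beta>))) = Z \<omega> n" for n \<omega>
    by (simp add: Z_def u_def \<theta>_def cis_mult algebra_simps)
  have irr: "2 * (h * \<alpha>) \<notin> \<rat>"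
  proof
    assume "2 * (h * \<alpha>) \<in> \<rat>"
    moreover have "(2 * of_int h :: real) \<in> \<rat>" by simp
    ultimately have "2 * (h * \<alpha>) / (2 * of_int h) \<in> \<rat>" by (rule Rats_divide)
    then show False using \<alpha> h by simp
  qed
  have tail: "\<bar>\<theta> n\<bar> / 3 ^ (s n + l) \<le> \<eta> l" for n l
  proof -
    have "\<bar>\<theta> n\<bar> / 3 ^ (s n + l) = 2 * pi * \<bar>h * \<alpha>\<bar> * (1 / 3) ^ l * mantissa3 D n"
      by (simp add: \<theta>_def mantissa3_def s_def abs_mult power_add power_one_over)
    also have "\<dots> \<le> 2 * pi * \<bar>h * \<alpha>\<bar> * (1 / 3) ^ l * 3"
      using mantissa3_bounds(2)[OF D, of n] by (intro mult_left_mono) auto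
    finally show ?thesis by (simp add: \<eta>_def)
  qed
  have diff: "cmod (Z \<omega> n - W l \<omega> n) \<le> \<eta> l + damping p l (2 * (h * \<alpha>) * mantissa3 D n) + of_bool (n < 2 * l)"
    for \<omega> n l
  proof -
    let ?m = "\<Prod>k=s n - l..<s n + l. coin_char p (2 * \<theta> n / 3 ^ Suc k)"
    have "cmod (Z \<omega> n - W l \<omega> n) \<le> \<bar>\<theta> n\<bar> / 3 ^ (s n + l) + cmod ?m"
      unfolding Z_def W_def by (rule cis_cantor_value_approx[OF u]) simp
    also have "cmod ?m \<le> damping p l (2 * (h * \<alpha>) * mantissa3 D n) + of_bool (n < 2 * l)"
    proof (cases "n < 2 * l")
      case True
      then show ?thesis
        using norm_prod_coin_char_le_1[of p "\<lambda>k. 2 * \<theta> n / 3 ^ Suc k" "{s n - l..<s n + l}"] p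
          damping_nonneg[of p l "2 * (h * \<alpha>) * mantissa3 D n"] by simp
    next
      case False
      then have "s 0 + l \<le> s n"
        using ternary_scale_growth[OF D, of 0 l] ternary_scale_mono[OF D, of "2 * l" n] by (simp add: s_def)
      then show ?thesis
        using norm_window_coin_char_le_damping[OF D, of p l n "h * \<alpha>"] p False
        by (simp add: s_def \<theta>_def)
    qed
    finally show ?thesis using tail[of n l] by linarith
  qed
  have "AE \<omega> in M. \<forall>l. (\<lambda>N. (\<Sum>n<N. W l \<omega> n) / of_nat N) \<longlonglongrightarrow> 0"
    unfolding M_def W_def s_def p_def AE_all_countable
    by (intro allI AE_average_fluctuation D) (rule u)
  then have "AE \<omega> in M. (\<lambda>N. (\<Sum>n<N. Z \<omega> n) / of_nat N) \<longlonglongrightarrow> 0"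
  proof eventually_elim
    case (elim \<omega>)
    show ?case
    proof (rule tendstoI)
      fix \<epsilon> :: real assume \<epsilon>: "\<epsilon> > 0"
      obtain L B where LB: "\<And>l N. l \<ge> L \<Longrightarrow>
          (\<Sum>n<N. damping p l (2 * (h * \<alpha>) * mantissa3 D n)) \<le> \<epsilon> / 5 * real N + B"
        using average_damping_small[OF D p irr, of "\<epsilon> / 5"] \<epsilon> by (metis divide_pos_pos zero_less_numeral)
      have "\<eta> \<longlonglongrightarrow> 6 * pi * \<bar>h * \<alpha>\<bar> * 0"
        unfolding \<eta>_def by (intro tendsto_mult_left LIMSEQ_power_zero) simp
      then have "\<forall>\<^sub>F l in sequentially. \<eta> l < \<epsilon> / 5"
        using \<epsilon> by (intro order_tendstoD(2)) auto
      then obtain l where l: "l \<ge> L" "\<eta> l < \<epsilon> / 5"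
        by (metis eventually_sequentially linorder_le_cases order_refl)
      have "\<forall>\<^sub>F N in sequentially. cmod ((\<Sum>n<N. W l \<omega> n) / of_nat N) < \<epsilon> / 5"
        using tendstoD[OF elim[rule_format, of l], of "\<epsilon> / 5"] \<epsilon> by simp
      moreover have "\<forall>\<^sub>F N in sequentially. (B + 2 * real l) / real N < \<epsilon> / 5"
        using \<epsilon> tendsto_divide_0[OF tendsto_const filterlim_real_at_infinity_sequentially, of "B + 2 * real l"]
        by (intro order_tendstoD(2)) auto
      ultimately show "\<forall>\<^sub>F N in sequentially. dist ((\<Sum>n<N. Z \<omega> n) / of_nat N) 0 < \<epsilon>"
        using eventually_gt_at_top[of "0::nat"]
      proof eventually_elim
        fix N assume N: "cmod ((\<Sum>n<N. W l \<omega> n) / of_nat N) < \<epsilon> / 5" "(B + 2 * real l) / real N < \<epsilon> / 5" "0 < N"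
        have "cmod ((\<Sum>n<N. Z \<omega> n) - (\<Sum>n<N. W l \<omega> n)) \<le>
            (\<Sum>n<N. \<eta> l + damping p l (2 * (h * \<alpha>) * mantissa3 D n) + of_bool (n < 2 * l))"
          unfolding sum_subtractf[symmetric] by (intro sum_norm_le diff)
        also have "\<dots> = \<eta> l * real N + (\<Sum>n<N. damping p l (2 * (h * \<alpha>) * mantissa3 D n))
            + (\<Sum>n<N. of_bool (n < 2 * l))"
          by (simp add: sum.distrib)
        also have "\<dots> \<le> \<epsilon> / 5 * real N + (\<epsilon> / 5 * real N + B) + 2 * real l"
        proof (intro add_mono LB l mult_right_mono)
          have "(\<Sum>n<N. of_bool (n < 2 * l)) = real (card ({..<N} \<inter> {n. n < 2 * l}))"
            by (simp add: sum_of_bool_eq)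
          also have "\<dots> \<le> real (card {..<2 * l})" by (intro of_nat_mono card_mono) auto
          finally show "(\<Sum>n<N. of_bool (n < 2 * l)) \<le> 2 * real l" by simp
        qed (use l in auto)
        finally have "cmod ((\<Sum>n<N. Z \<omega> n) - (\<Sum>n<N. W l \<omega> n)) / real N \<le>
            (\<epsilon> / 5 * real N + (\<epsilon> / 5 * real N + B) + 2 * real l) / real N"
          by (rule divide_right_mono) simp
        also have "\<dots> = 2 * (\<epsilon> / 5) + (B + 2 * real l) / real N" using N(3) by (simp add: field_simps)
        finally have "cmod ((\<Sum>n<N. Z \<omega> n) - (\<Sum>n<N. W l \<omega> n)) / real N < 3 * (\<epsilon> / 5)"
          using N(2) by linarith
        moreover have "cmod ((\<Sum>n<N. Z \<omega> n) / of_nat N - (\<Sum>n<N. W l \<omega> n) / of_nat N) =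
            cmod ((\<Sum>n<N. Z \<omega> n) - (\<Sum>n<N. W l \<omega> n)) / real N"
          by (simp add: norm_divide flip: diff_divide_distrib)
        ultimately have "cmod ((\<Sum>n<N. Z \<omega> n) / of_nat N) < 4 * (\<epsilon> / 5)"
          using N(1) norm_triangle_sub[of "(\<Sum>n<N. Z \<omega> n) / of_nat N" "(\<Sum>n<N. W l \<omega> n) / of_nat N"] by linarith
        then show "dist ((\<Sum>n<N. Z \<omega> n) / of_nat N) 0 < \<epsilon>" using \<epsilon> unfolding dist_norm diff_0_right by linarith
      qed
    qed
  qed
  then show ?thesis unfolding Z M_def .
qed

section \<open>Almost sure normality\<close>

text \<open>
  Convergence with countably many quantifiers, which makes sets of convergence measurable.
\<close>
lemma LIMSEQ_0_iff_inverse_Suc: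
  fixes X :: "nat \<Rightarrow> 'a::real_normed_vector"
  shows "X \<longlonglongrightarrow> 0 \<longleftrightarrow> (\<forall>i::nat. \<exists>N0. \<forall>N\<ge>N0. norm (X N) < inverse (real (Suc i)))"
proof
  assume "X \<longlonglongrightarrow> 0"
  then show "\<forall>i::nat. \<exists>N0. \<forall>N\<ge>N0. norm (X N) < inverse (real (Suc i))"
    unfolding LIMSEQ_iff by (metis diff_0_right inverse_positive_iff_positive of_nat_0_less_iff zero_less_Suc)
next
  assume X: "\<forall>i::nat. \<exists>N0. \<forall>N\<ge>N0. norm (X N) < inverse (real (Suc i))"
  show "X \<longlonglongrightarrow> 0"
    unfolding LIMSEQ_iff
  proof (intro allI impI)
    fix r :: real assume "r > 0"
    then obtain i where "inverse (real (Suc i)) < r" using reals_Archimedean by blast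
    then show "\<exists>N0. \<forall>N\<ge>N0. norm (X N - 0) < r" using X by (metis diff_0_right less_trans)
  qed
qed

text \<open>
  Only countably many pairs of a base and a frequency occur, so one null set serves them all.
\<close>
lemma AE_bernoulli_normal:
  assumes \<alpha>: "\<alpha> \<notin> \<rat>" and \<mu>: "bernoulli_measure (scaled_cantor_ifs \<alpha> \<beta>) \<mu>"
  shows "AE x in \<mu>. \<forall>D\<ge>2. normal_to_base D x"
proof -
  obtain P :: "bool pmf" where P: "\<And>i. pmf P i > 0"
    and \<mu>_eq: "\<mu> = distr (PiM UNIV (\<lambda>_::nat. measure_pmf P)) borel (coding_map (scaled_cantor_ifs \<alpha> \<beta>))"
    using \<mu> by (auto simp: bernoulli_measure_def)
  define M where "M = PiM UNIV (\<lambda>_::nat. measure_pmf P)"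
  define avg :: "nat \<Rightarrow> int \<Rightarrow> real \<Rightarrow> nat \<Rightarrow> complex" where
    "avg D h x N = (\<Sum>n<N. cis (2 * pi * h * (real D ^ n * x))) / of_nat N" for D h x N
  have coding: "coding_map (scaled_cantor_ifs \<alpha> \<beta>) = (\<lambda>\<omega>. \<alpha> * cantor_value \<omega> + \<beta>)"
    by (rule ext) (rule coding_map_scaled_cantor_ifs)
  have [measurable]: "coding_map (scaled_cantor_ifs \<alpha> \<beta>) \<in> M \<rightarrow>\<^sub>M borel"
    unfolding coding M_def by measurable
  have "AE x in \<mu>. avg D h x \<longlonglongrightarrow> 0" if "D \<ge> 2" "h \<noteq> 0" for D h
  proof -
    have [measurable]: "(\<lambda>x. avg D h x N) \<in> borel_measurable borel" for N
      unfolding avg_def by (cases "N = 0") (auto intro!: borel_measurable_continuous_onI continuous_intros)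
    have "{x \<in> space borel. avg D h x \<longlonglongrightarrow> 0} =
        {x \<in> space borel. \<forall>i::nat. \<exists>N0. \<forall>N\<ge>N0. cmod (avg D h x N) < inverse (real (Suc i))}"
      unfolding LIMSEQ_0_iff_inverse_Suc ..
    also have "\<dots> \<in> sets borel" by measurable
    finally have meas: "{x \<in> space borel. avg D h x \<longlonglongrightarrow> 0} \<in> sets borel" .
    have "AE \<omega> in M. avg D h (coding_map (scaled_cantor_ifs \<alpha> \<beta>) \<omega>) \<longlonglongrightarrow> 0"
      unfolding coding avg_def M_def using AE_weyl_average[OF P \<alpha> that] by simp
    then show ?thesis
      unfolding \<mu>_eq M_def[symmetric] by (subst AE_distr_iff[OF _ meas]) auto
  qed
  then have "AE x in \<mu>. \<forall>D h. D \<ge> 2 \<longrightarrow> h \<noteq> 0 \<longrightarrow> avg D h x \<longlonglongrightarrow> 0"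
    unfolding AE_all_countable by (intro allI AE_impI) auto
  then show ?thesis
  proof eventually_elim
    case (elim x)
    then have "weyl_sequence (\<lambda>n. real D ^ n * x)" if "D \<ge> 2" for D
      using that by unfold_locales (auto simp: avg_def[abs_def])
    then show ?case using normal_to_base_if_weyl by blast
  qed
qed

theorem corollary5:
  fixes \<alpha> \<beta> :: real and K :: "real set" and \<Phi> :: "bool \<Rightarrow> real \<Rightarrow> real"
  assumes "\<alpha> \<notin> \<rat>"
    and "K = (\<lambda>c. \<alpha> * c + \<beta>) ` cantor_set"
    and "\<Phi> = (\<lambda>i. if i then (\<lambda>x. 1 / 3 * x + 2 * \<alpha> / 3 + 2 * \<beta> / 3)
                     else (\<lambda>x. 1 / 3 * x + 2 * \<beta> / 3))"
  shows "is_ifs \<Phi> \<and> is_attractor \<Phi> K \<and>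
    (\<forall>\<mu>. bernoulli_measure \<Phi> \<mu> \<longrightarrow> (AE x in \<mu>. \<forall>D\<ge>2. normal_to_base D x))"
proof -
  have "\<Phi> = scaled_cantor_ifs \<alpha> \<beta>" by (simp add: assms(3) scaled_cantor_ifs_def)
  then show ?thesis
    using scaled_cantor_ifs_is_ifs scaled_cantor_ifs_attractor AE_bernoulli_normal[OF assms(1)] assms(2) by blast
qed

end
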